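(* Let $a\colon\mathbb{N}\to\mathbb{C}$ be a bounded sequence satisfying $$\sum_{n\leq x} a(pn)\overline{a(qn)} = o(x)\quad(x\to\infty)\qquad\text{for all primes $p,q$ with $p\neq q$.}$$ Then for all sets $E\subset\mathbb{N}$ belonging to either $\mathcal{E}_{\mathrm{c.pt.}}^{(\infty)}$ or $\mathcal{E}_{\partial}$ we have $$\sum_{n\leq x} \mathbf{1}_{E}(n)\,a(n)=o(x)\quad(x\to\infty).$$
   Context: $\mathbb{N}=\{1,2,\ldots\}$; $\mathbf{1}_E$ is the indicator function of $E$. A function $f\colon\mathbb{N}\to\mathbb{C}$ is multiplicative if $f(1)=1$ and $f(mn)=f(m)f(n)$ whenever $\gcd(m,n)=1$. $\mathcal{M}$ denotes the set of multiplicative $f\colon\mathbb{N}\to\mathbb{C}$ with $\sup_n|f(n)|\le 1$. For bounded $f\colon\mathbb{N}\to\mathbb{C}$, $\|f\|_1:=\limsup_{N\to\infty}\frac1N\sum_{n=1}^N|f(n)|$. A function $\vec f=(f_1,\ldots,f_r)\colon\mathbb{N}\to\mathbb{C}^r$ is multiplicative if each $f_i$ is multiplicative; $\vec z\in\mathbb{C}^r$ is a concentration point for $\vec f$ if $\sum_{p\text{ prime},\,\vec f(p)=\vec z}\frac1p=\infty$. $\mathcal{E}_{\mathrm{c.pt.}}^{(r)}$ is the collection of all sets $\{n\in\mathbb{N}:\vec f(n)\in K\}$, where $K\subset\mathbb{C}^r$ is arbitrary and $\vec f\colon\mathbb{N}\to\mathbb{C}^r$ is a multiplicative function possessing at least one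 concentration point; $\mathcal{E}_{\mathrm{c.pt.}}^{(\infty)}:=\bigcup_{r\ge1}\mathcal{E}_{\mathrm{c.pt.}}^{(r)}$. For $f\colon\mathbb{N}\to\mathbb{C}$, the class $\mathcal{N}(f)$ of $f$-null sets consists of all $C\subset\mathbb{C}\setminus\{0\}$ such that for every $\epsilon>0$ there is a continuous $F\colon\mathbb{C}\to[0,1]$ with $F(z)=1$ for all $z\in C$ and $\limsup_{N\to\infty}\frac1N\sum_{1\le n\le N,\,f(n)\neq0}F(f(n))\le\epsilon$. For $J\subset\mathbb{C}$, $\partial J:=\overline J\setminus J^\circ$. For multiplicative $f$ put $\mathcal{A}^*(f):=\{J\subset\mathbb{C}\setminus\{0\}:\partial J\setminus\{0\}\in\mathcal{N}(f)\}$ and $\mathcal{A}(f):=\mathcal{A}^*(f)\cup\{J\cup\{0\}:J\in\mathcal{A}^*(f)\}$. $\mathcal{E}_\partial$ is the collection of all sets $\{n\in\mathbb{N}:f(n)\in K\}$, where $f\in\mathcal{M}$ with $\|f\|_1\neq0$ and $K\in\mathcal{A}(f)$. *)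

theory Defs
  imports "HOL-Analysis.Analysis" "HOL-Library.Landau_Symbols" "HOL-Computational_Algebra.Primes"
begin

text \<open>
  The positive integers are represented inside \<^typ>\<open>nat\<close>. Every sum, set and condition below is
  restricted to arguments \<open>n \<ge> 1\<close>, so the value of an arithmetic function at \<open>0\<close> is irrelevant.
\<close>

definition multiplicative_fun :: "(nat \<Rightarrow> complex) \<Rightarrow> bool" where
  "multiplicative_fun f \<longleftrightarrow>
     f 1 = 1 \<and> (\<forall>m\<ge>1. \<forall>n\<ge>1. coprime m n \<longrightarrow> f (m * n) = f m * f n)"

definition mult_unit_disc :: "(nat \<Rightarrow> complex) set" where
  "mult_unit_disc = {f. multiplicative_fun f \<and> (\<forall>n\<ge>1. norm (f n) \<le> 1)}"

definition norm1 :: "(nat \<Rightarrow> complex) \<Rightarrow> ereal" where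
  "norm1 f = limsup (\<lambda>N. ereal ((\<Sum>n=1..N. norm (f n)) / real N))"

text \<open>The dimension \<open>r\<close> is quantified below, so vectors in \<open>\<complex>\<^sup>r\<close> are lists of length \<open>r\<close>.\<close>

definition cvec :: "nat \<Rightarrow> complex list set" where
  "cvec r = {v. length v = r}"

definition multiplicative_vec :: "nat \<Rightarrow> (nat \<Rightarrow> complex list) \<Rightarrow> bool" where
  "multiplicative_vec r f \<longleftrightarrow>
     (\<forall>n\<ge>1. f n \<in> cvec r) \<and> (\<forall>i<r. multiplicative_fun (\<lambda>n. f n ! i))"

text \<open>The terms are nonnegative, so the sum is infinite iff the family is not summable.\<close>

definition concentration_point :: "(nat \<Rightarrow> complex list) \<Rightarrow> complex list \<Rightarrow> bool" where
  "concentration_point f z \<longleftrightarrow> \<not> (\<lambda>p. 1 / real p) summable_on {p. prime p \<and> f p = z}"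

definition E_cpt :: "nat \<Rightarrow> nat set set" where
  "E_cpt r = {{n. n \<ge> 1 \<and> f n \<in> K} | f K.
     K \<subseteq> cvec r \<and> multiplicative_vec r f \<and> (\<exists>z\<in>cvec r. concentration_point f z)}"

definition E_cpt_infinity :: "nat set set" where
  "E_cpt_infinity = (\<Union>r\<in>{1..}. E_cpt r)"

definition null_sets_of :: "(nat \<Rightarrow> complex) \<Rightarrow> complex set set" where
  "null_sets_of f = {C. C \<subseteq> - {0} \<and>
     (\<forall>\<epsilon>::real. \<epsilon> > 0 \<longrightarrow>
       (\<exists>F :: complex \<Rightarrow> real. continuous_on UNIV F \<and> range F \<subseteq> {0..1} \<and> (\<forall>z\<in>C. F z = 1) \<and>
          limsup (\<lambda>N. ereal ((\<Sum>n | 1 \<le> n \<and> n \<le> N \<and> f n \<noteq> 0. F (f n)) / real N)) \<le> ereal \<epsilon>))}"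

definition A_star :: "(nat \<Rightarrow> complex) \<Rightarrow> complex set set" where
  "A_star f = {J. J \<subseteq> - {0} \<and> frontier J - {0} \<in> null_sets_of f}"

definition A_class :: "(nat \<Rightarrow> complex) \<Rightarrow> complex set set" where
  "A_class f = A_star f \<union> {J \<union> {0} | J. J \<in> A_star f}"

definition E_boundary :: "nat set set" where
  "E_boundary = {{n. n \<ge> 1 \<and> f n \<in> K} | f K.
     f \<in> mult_unit_disc \<and> norm1 f \<noteq> 0 \<and> K \<in> A_class f}"

end

theory Submission
  imports Defs "HOL-Number_Theory.Prime_Powers"
begin

text \<open>
  Let \<open>P\<close> be a finite set of primes and \<open>L = (\<Sum>p\<in>P. 1/p)\<close>. By the Turan--Kubilius inequality
  the number of \<open>p \<in> P\<close> that divide \<open>n\<close> differs from \<open>L\<close> by \<open>O(\<surd>L)\<close> in mean square, so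
  for bounded \<open>b\<close> the sum \<open>L * (\<Sum>n\<le>N. b n)\<close> equals \<open>(\<Sum>p\<in>P. \<Sum>m\<le>N/p. b (p * m))\<close> up to
  \<open>O(N * \<surd>L)\<close> (\<open>turan_kubilius_dual\<close>). Katai's method applies this to \<open>b = g * a\<close> where
  \<open>g (p * m) = c p * h m\<close> whenever \<open>p\<close> does not divide \<open>m\<close>. The Cauchy--Schwarz inequality in \<open>m\<close>
  removes \<open>h\<close> and leaves the correlations of \<open>a (p * m)\<close> and \<open>a (q * m)\<close>; those with \<open>p \<noteq> q\<close>
  are \<open>o(N)\<close> and the diagonal is \<open>O(N * L)\<close>. Hence the mean of \<open>g * a\<close> is \<open>O(1/\<surd>L)\<close>, and \<open>L\<close> can
  be taken arbitrarily large as soon as the available primes have a divergent sum of reciprocals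
  (\<open>katai_criterion\<close>).

  If \<open>f\<close> has a concentration point \<open>z\<close>, then \<open>f (p * m) = z * f m\<close> whenever \<open>f p = z\<close> and \<open>p\<close>
  does not divide \<open>m\<close>, and whether this lies in \<open>K\<close> does not depend on \<open>p\<close>. So the indicator
  function of any level set of \<open>f\<close> is an admissible \<open>g\<close>, with \<open>c = 1\<close>.

  For a level set \<open>{n. f n \<in> J}\<close> of a multiplicative \<open>f\<close> into the unit disc, the criterion holds for
  each monomial \<open>f ^ i * cnj f ^ j\<close>, hence by the Stone--Weierstrass theorem for \<open>G (f n)\<close> with \<open>G\<close>
  continuous. It remains to approximate the indicator of \<open>J\<close> in mean along \<open>f\<close> by a continuous
  function. The nullity of the boundary provides a continuous \<open>F\<close> that is \<open>1\<close> on the boundary of \<open>J\<close>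
  outside \<open>0\<close> and has small mean; multiplying by \<open>1 - F\<close> removes every discontinuity except a possible
  one at \<open>0\<close>. Multiplying by \<open>norm z powr s\<close> removes that one too. The price is the mean of
  \<open>of_bool (f n \<noteq> 0) - norm (f n) powr s\<close>, which tends to \<open>0\<close> with \<open>s\<close>, uniformly in \<open>N\<close>
  (\<open>small_power_close_to_support\<close>): it is at most the sum of
  \<open>(of_bool (f q \<noteq> 0) - norm (f q) powr s) / q\<close> over prime powers \<open>q\<close>, and dominated convergence
  applies if \<open>(1 - norm (f p)) / p\<close> is summable over the primes. That summability
  follows from \<open>norm1 f \<noteq> 0\<close>: by Turan--Kubilius with the weights \<open>1 - norm (f p)\<close>, divergence would
  force \<open>norm \<circ> f\<close> to have mean \<open>0\<close> (\<open>norm1_nonzero_imp_summable\<close>).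

  The divergence of the sum of the reciprocals of the primes comes from the same estimate,
  applied to \<open>f n = 1 / n\<close>.
\<close>

section \<open>The Turan--Kubilius inequality\<close>

lemma sum_over_multiples:
  fixes b :: "nat \<Rightarrow> 'a::comm_monoid_add"
  assumes "d \<ge> 1"
  shows "(\<Sum>n=1..N. if d dvd n then b n else 0) = (\<Sum>m=1..N div d. b (d * m))"
proof -
  have "(\<Sum>n=1..N. if d dvd n then b n else 0) = (\<Sum>n | n \<in> {1..N} \<and> d dvd n. b n)"
    by (subst sum.inter_filter) auto
  also have "\<dots> = (\<Sum>m=1..N div d. b (d * m))"
    using assms
    by (intro sum.reindex_bij_witness[of _ "\<lambda>m. d * m" "\<lambda>n. n div d"])
       (auto simp: div_le_mono less_eq_div_iff_mult_less_eq mult.commute dvd_div_eq_0_iff Suc_le_eq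
             intro!: Nat.gr0I)
  finally show ?thesis .
qed

definition weighted_omega :: "nat set \<Rightarrow> (nat \<Rightarrow> real) \<Rightarrow> nat \<Rightarrow> real" where
  "weighted_omega P w n = (\<Sum>p\<in>P. if p dvd n then w p else 0)"

text \<open>
  Interchanging the summations turns a weight \<open>weighted_omega\<close> into sums along multiples. Besides
  primes the set \<open>P\<close> may contain prime powers, which the comparison of two multiplicative functions
  needs.
\<close>
lemma sum_weighted_omega:
  fixes b :: "nat \<Rightarrow> 'a::real_normed_field"
  assumes "\<And>p. p \<in> P \<Longrightarrow> p > 0"
  shows "(\<Sum>n=1..N. of_real (weighted_omega P w n) * b n)
       = (\<Sum>p\<in>P. of_real (w p) * (\<Sum>m=1..N div p. b (p * m)))"
proof -
  have "(\<Sum>n=1..N. of_real (weighted_omega P w n) * b n)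
      = (\<Sum>n=1..N. \<Sum>p\<in>P. of_real (w p) * (if p dvd n then b n else 0))"
    by (auto simp: weighted_omega_def sum_distrib_right intro!: sum.cong)
  also have "\<dots> = (\<Sum>p\<in>P. of_real (w p) * (\<Sum>n=1..N. if p dvd n then b n else 0))"
    by (subst sum.swap) (simp add: sum_distrib_left)
  also have "\<dots> = (\<Sum>p\<in>P. of_real (w p) * (\<Sum>m=1..N div p. b (p * m)))"
    by (intro sum.cong refl arg_cong2[where f = "(*)"] sum_over_multiples)
       (simp add: assms Suc_le_eq)
  finally show ?thesis .
qed

text \<open>
  Expanding the square reduces the claim to a lower bound for the first moment, where each rounding
  \<open>N div p\<close> loses at most \<open>1\<close>, and an upper bound for the second moment. The latter is a sum of
  values of \<open>weighted_omega\<close> along the multiples of \<open>p\<close>; passing from \<open>m\<close> to \<open>p * m\<close> raises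
  the value by at most \<open>w p \<le> 1\<close>, which adds \<open>L\<close> to the expected \<open>L\<^sup>2\<close>.
\<close>
lemma turan_kubilius:
  fixes N :: nat and L :: real
  assumes fin: "finite P" and prime: "\<And>p. p \<in> P \<Longrightarrow> prime p"
    and w: "\<And>p. p \<in> P \<Longrightarrow> 0 \<le> w p" "\<And>p. p \<in> P \<Longrightarrow> w p \<le> 1"
  defines "L \<equiv> \<Sum>p\<in>P. w p / real p"
  shows "(\<Sum>n=1..N. (weighted_omega P w n - L)\<^sup>2) \<le> N * L + 2 * L * card P"
proof -
  have pos: "p > 0" if "p \<in> P" for p using prime[OF that] by (simp add: prime_gt_0_nat)
  have L0: "L \<ge> 0" unfolding L_def by (intro sum_nonneg) (auto simp: w)
  have first: "(\<Sum>n=1..N. weighted_omega P w n) \<ge> N * L - card P"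
  proof -
    have "N * L - card P = (\<Sum>p\<in>P. N * (w p / p) - 1)"
      by (simp add: L_def sum_subtractf sum_distrib_left)
    also have "\<dots> \<le> (\<Sum>p\<in>P. w p * (N div p))"
    proof (intro sum_mono)
      fix p assume p: "p \<in> P"
      have "real N / p - 1 \<le> \<lfloor>real N / p\<rfloor>" by linarith
      also have "\<dots> = N div p" by (simp only: floor_divide_of_nat_eq of_int_of_nat_eq)
      finally have "real N / p - 1 \<le> N div p" .
      from mult_left_mono[OF this w(1)[OF p]] w(2)[OF p]
      show "N * (w p / p) - 1 \<le> w p * (N div p)" by (simp add: algebra_simps)
    qed
    also have "\<dots> = (\<Sum>n=1..N. weighted_omega P w n)"
      using sum_weighted_omega[OF pos, where P = P and N = N and w = w and b = "\<lambda>_. 1::real"] by simp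
    finally show ?thesis .
  qed
  have second: "(\<Sum>n=1..N. (weighted_omega P w n)\<^sup>2) \<le> N * L\<^sup>2 + N * L"
  proof -
    have "(\<Sum>n=1..N. (weighted_omega P w n)\<^sup>2)
        = (\<Sum>p\<in>P. w p * (\<Sum>m=1..N div p. weighted_omega P w (p * m)))"
      using sum_weighted_omega[OF pos, where P = P and N = N and w = w and b = "weighted_omega P w"]
      by (simp add: power2_eq_square)
    also have "\<dots> \<le> (\<Sum>p\<in>P. w p * (N / p * L + N / p))"
    proof (intro sum_mono mult_left_mono w(1))
      fix p assume p: "p \<in> P"
      have "(\<Sum>m=1..N div p. weighted_omega P w (p * m))
          \<le> (\<Sum>m=1..N div p. weighted_omega P w m + 1)"
      proof (intro sum_mono)
        fix m
        \<comment> \<open>Multiplication by \<open>p\<close> creates no prime divisor other than \<open>p\<close> itself.\<close>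
        have "weighted_omega P w (p * m)
            \<le> (\<Sum>q\<in>P. (if q dvd m then w q else 0) + (if q = p then 1 else 0))"
          unfolding weighted_omega_def
          using prime p w by (intro sum_mono) (auto simp: prime_dvd_mult_iff primes_dvd_imp_eq)
        also have "\<dots> = weighted_omega P w m + 1"
          using fin p by (simp add: weighted_omega_def sum.distrib)
        finally show "weighted_omega P w (p * m) \<le> weighted_omega P w m + 1" .
      qed
      also have "\<dots> = (\<Sum>q\<in>P. w q * ((N div p) div q)) + N div p"
        using sum_weighted_omega[OF pos, where P = P and N = "N div p" and w = w and b = "\<lambda>_. 1::real"]
        by (simp add: sum.distrib)
      also have "\<dots> \<le> (\<Sum>q\<in>P. w q * (N / p / q)) + N / p"
      proof (intro add_mono sum_mono mult_left_mono w(1))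
        fix q
        have "real (N div p div q) \<le> real (N div p) / q" by (rule of_nat_div_le_of_nat)
        also have "\<dots> \<le> N / p / q" by (intro divide_right_mono of_nat_div_le_of_nat) auto
        finally show "real (N div p div q) \<le> N / p / q" .
      qed (auto intro: of_nat_div_le_of_nat)
      also have "\<dots> = N / p * L + N / p"
        by (simp add: L_def sum_distrib_left field_simps)
      finally show "(\<Sum>m=1..N div p. weighted_omega P w (p * m)) \<le> N / p * L + N / p" .
    qed
    also have "\<dots> = (\<Sum>p\<in>P. (w p / p) * (N * L + N))"
      by (intro sum.cong) (auto simp: algebra_simps add_divide_distrib)
    also have "\<dots> = N * L\<^sup>2 + N * L"
      unfolding sum_distrib_right[symmetric] L_def[symmetric]
      by (simp add: power2_eq_square algebra_simps)
    finally show ?thesis .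
  qed
  have "(\<Sum>n=1..N. (weighted_omega P w n - L)\<^sup>2)
      = (\<Sum>n=1..N. (weighted_omega P w n)\<^sup>2) - 2 * L * (\<Sum>n=1..N. weighted_omega P w n) + N * L\<^sup>2"
    by (simp add: power2_diff sum.distrib sum_subtractf sum_distrib_left mult_ac)
  also have "\<dots> \<le> (N * L\<^sup>2 + N * L) - 2 * L * (N * L - card P) + N * L\<^sup>2"
    using second mult_left_mono[OF first, of "2 * L"] L0 by linarith
  also have "\<dots> = N * L + 2 * L * card P"
    by (simp add: algebra_simps power2_eq_square)
  finally show ?thesis .
qed

lemma sum_le_sqrt_sum_squares:
  fixes x :: "nat \<Rightarrow> real"
  shows "(\<Sum>n=1..N. x n) \<le> sqrt (N * (\<Sum>n=1..N. (x n)\<^sup>2))"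
  using Cauchy_Schwarz_ineq_sum[of "\<lambda>_. 1" x "{1..N}"] by (intro real_le_rsqrt) simp

text \<open>
  Since \<open>weighted_omega\<close> is close to the constant \<open>L\<close> in mean square, it can replace \<open>L\<close> as a
  factor of a bounded sequence. The lower bound on \<open>N\<close> makes the error term \<open>2 * L * card P\<close> of the
  inequality at most \<open>N * L\<close>.
\<close>
lemma turan_kubilius_dual:
  fixes b :: "nat \<Rightarrow> 'a::real_normed_field" and N :: nat and L :: real
  assumes fin: "finite P" and prime: "\<And>p. p \<in> P \<Longrightarrow> prime p"
    and w: "\<And>p. p \<in> P \<Longrightarrow> 0 \<le> w p" "\<And>p. p \<in> P \<Longrightarrow> w p \<le> 1"
    and b: "\<And>n. n \<ge> 1 \<Longrightarrow> norm (b n) \<le> B"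
    and N: "N \<ge> 2 * card P"
  defines "L \<equiv> \<Sum>p\<in>P. w p / real p"
  shows "norm (of_real L * (\<Sum>n=1..N. b n) - (\<Sum>p\<in>P. of_real (w p) * (\<Sum>m=1..N div p. b (p * m))))
      \<le> B * (N * sqrt (2 * L))"
proof -
  have pos: "p > 0" if "p \<in> P" for p using prime[OF that] by (simp add: prime_gt_0_nat)
  have L0: "L \<ge> 0" unfolding L_def by (intro sum_nonneg) (auto simp: w)
  have B0: "B \<ge> 0" using b[of 1] norm_ge_zero[of "b 1"] by linarith
  have "of_real L * (\<Sum>n=1..N. b n) - (\<Sum>p\<in>P. of_real (w p) * (\<Sum>m=1..N div p. b (p * m)))
      = (\<Sum>n=1..N. of_real (L - weighted_omega P w n) * b n)"
    using sum_weighted_omega[OF pos, where P = P and N = N and w = w and b = b]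
    by (simp add: algebra_simps sum_subtractf sum_distrib_left)
  also have "norm \<dots> \<le> (\<Sum>n=1..N. B * \<bar>weighted_omega P w n - L\<bar>)"
    by (intro sum_norm_le) (auto simp: norm_mult b mult.commute abs_minus_commute simp flip: of_real_diff
          intro!: mult_right_mono)
  also have "\<dots> \<le> B * sqrt (N * (\<Sum>n=1..N. (weighted_omega P w n - L)\<^sup>2))"
    using mult_left_mono[OF sum_le_sqrt_sum_squares[of "\<lambda>n. \<bar>weighted_omega P w n - L\<bar>" N] B0]
    by (simp add: sum_distrib_left)
  also have "\<dots> \<le> B * sqrt (N * (2 * L * N))"
  proof (intro mult_left_mono real_sqrt_le_mono B0)
    have "real (2 * card P) \<le> N" using N by (simp only: of_nat_le_iff)
    from mult_left_mono[OF this L0]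
    have "N * L + 2 * L * card P \<le> 2 * L * N" by (simp add: algebra_simps)
    with turan_kubilius[where P = P and w = w and N = N, OF fin prime w]
    show "(\<Sum>n=1..N. (weighted_omega P w n - L)\<^sup>2) \<le> 2 * L * N"
      unfolding L_def by linarith
  qed auto
  also have "N * (2 * L * N) = (real N)\<^sup>2 * (2 * L)" by (simp add: power2_eq_square)
  finally show ?thesis by (simp add: real_sqrt_mult)
qed

section \<open>Sequences of mean zero\<close>

definition zero_mean :: "(nat \<Rightarrow> complex) \<Rightarrow> bool" where
  "zero_mean b \<longleftrightarrow> (\<forall>\<epsilon>>0. \<forall>\<^sub>F N in sequentially. norm (\<Sum>n=1..N. b n) \<le> \<epsilon> * real N)"

lemma zero_meanD:
  "zero_mean b \<Longrightarrow> \<epsilon> > 0 \<Longrightarrow> \<forall>\<^sub>F N in sequentially. norm (\<Sum>n=1..N. b n) \<le> \<epsilon> * real N"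
  by (simp add: zero_mean_def)

lemma zero_mean_cong:
  assumes "zero_mean b" "\<And>n. n \<ge> 1 \<Longrightarrow> b n = b' n"
  shows "zero_mean b'"
proof -
  have "(\<Sum>n=1..N. b n) = (\<Sum>n=1..N. b' n)" for N
    using assms(2) by (intro sum.cong) auto
  with assms(1) show ?thesis by (simp add: zero_mean_def)
qed

lemma zero_mean_add:
  assumes "zero_mean b" "zero_mean b'"
  shows "zero_mean (\<lambda>n. b n + b' n)"
  unfolding zero_mean_def
proof (intro allI impI)
  fix \<epsilon> :: real assume "\<epsilon> > 0"
  hence "\<epsilon> / 2 > 0" by simp
  from zero_meanD[OF assms(1) this] zero_meanD[OF assms(2) this]
  show "\<forall>\<^sub>F N in sequentially. norm (\<Sum>n=1..N. b n + b' n) \<le> \<epsilon> * real N"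
  proof eventually_elim
    case (elim N)
    thus ?case using norm_triangle_ineq[of "\<Sum>n=1..N. b n" "\<Sum>n=1..N. b' n"]
      by (simp add: sum.distrib)
  qed
qed

lemma zero_mean_cmult:
  assumes "zero_mean b"
  shows "zero_mean (\<lambda>n. c * b n)"
proof (cases "c = 0")
  case False
  show ?thesis unfolding zero_mean_def
  proof (intro allI impI)
    fix \<epsilon> :: real assume "\<epsilon> > 0"
    hence "\<forall>\<^sub>F N in sequentially. norm (\<Sum>n=1..N. b n) \<le> \<epsilon> / norm c * real N"
      using assms False by (intro zero_meanD) auto
    thus "\<forall>\<^sub>F N in sequentially. norm (\<Sum>n=1..N. c * b n) \<le> \<epsilon> * real N"
      by eventually_elim (use False in \<open>simp add: norm_mult field_simps flip: sum_distrib_left\<close>)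
  qed
qed (simp add: zero_mean_def)

text \<open>
  Sequences of mean zero are closed under approximation in the \<open>L\<^sup>1\<close> seminorm.
\<close>
lemma zero_mean_approx:
  assumes "\<And>\<epsilon>. \<epsilon> > 0 \<Longrightarrow> \<exists>b'. zero_mean b' \<and>
    (\<forall>\<^sub>F N in sequentially. (\<Sum>n=1..N. norm (b n - b' n)) \<le> \<epsilon> * real N)"
  shows "zero_mean b"
  unfolding zero_mean_def
proof (intro allI impI)
  fix \<epsilon> :: real assume "\<epsilon> > 0"
  then obtain b' where b': "zero_mean b'"
    and ev: "\<forall>\<^sub>F N in sequentially. (\<Sum>n=1..N. norm (b n - b' n)) \<le> \<epsilon> / 2 * real N"
    using assms[of "\<epsilon> / 2"] by auto
  from b' \<open>\<epsilon> > 0\<close> have "\<forall>\<^sub>F N in sequentially. norm (\<Sum>n=1..N. b' n) \<le> \<epsilon> / 2 * real N"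
    by (intro zero_meanD) auto
  with ev show "\<forall>\<^sub>F N in sequentially. norm (\<Sum>n=1..N. b n) \<le> \<epsilon> * real N"
  proof eventually_elim
    case (elim N)
    have "norm (\<Sum>n=1..N. b n) = norm ((\<Sum>n=1..N. b n - b' n) + (\<Sum>n=1..N. b' n))"
      by (simp add: sum_subtractf)
    also have "\<dots> \<le> (\<Sum>n=1..N. norm (b n - b' n)) + norm (\<Sum>n=1..N. b' n)"
      by (intro norm_triangle_mono norm_sum) auto
    finally show ?case using elim by simp
  qed
qed

lemma smallo_iff_zero_mean:
  "(\<lambda>x::real. \<Sum>n | 1 \<le> n \<and> real n \<le> x. b n) \<in> o[at_top](\<lambda>x. complex_of_real x)
     \<longleftrightarrow> zero_mean b"
proof
  have interval: "{n. 1 \<le> n \<and> real n \<le> x} = {1..nat \<lfloor>x\<rfloor>}" for x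
  proof -
    have "n \<le> nat \<lfloor>x\<rfloor> \<longleftrightarrow> real n \<le> x" if "n \<ge> 1" for n
    proof -
      have "n \<le> nat \<lfloor>x\<rfloor> \<longleftrightarrow> int n \<le> \<lfloor>x\<rfloor>" using that by linarith
      thus ?thesis by (simp add: le_floor_iff)
    qed
    thus ?thesis by auto
  qed
  {
    assume small: "(\<lambda>x::real. \<Sum>n | 1 \<le> n \<and> real n \<le> x. b n) \<in> o[at_top](\<lambda>x. complex_of_real x)"
    show "zero_mean b" unfolding zero_mean_def
    proof (intro allI impI)
      fix \<epsilon> :: real assume "\<epsilon> > 0"
      from eventually_compose_filterlim[OF landau_o.smallD[OF small this] filterlim_real_sequentially]
      show "\<forall>\<^sub>F N in sequentially. norm (\<Sum>n=1..N. b n) \<le> \<epsilon> * real N"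
        by (simp only: interval floor_of_nat nat_int norm_of_real abs_of_nat)
    qed
  }
  assume zero: "zero_mean b"
  show "(\<lambda>x::real. \<Sum>n | 1 \<le> n \<and> real n \<le> x. b n) \<in> o[at_top](\<lambda>x. complex_of_real x)"
  proof (rule landau_o.smallI)
    fix \<epsilon> :: real assume \<epsilon>: "\<epsilon> > 0"
    have lim: "filterlim (\<lambda>x::real. nat \<lfloor>x\<rfloor>) sequentially at_top"
      by (intro filterlim_compose[OF filterlim_nat_sequentially] filterlim_floor_sequentially)
    have "\<forall>\<^sub>F x::real in at_top. norm (\<Sum>n=1..nat \<lfloor>x\<rfloor>. b n) \<le> \<epsilon> * real (nat \<lfloor>x\<rfloor>)"
      by (rule eventually_compose_filterlim[OF zero_meanD[OF zero \<epsilon>] lim])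
    thus "\<forall>\<^sub>F x::real in at_top. norm (\<Sum>n | 1 \<le> n \<and> real n \<le> x. b n) \<le> \<epsilon> * norm (complex_of_real x)"
      using eventually_ge_at_top[of 0]
    proof eventually_elim
      case (elim x)
      have "\<epsilon> * real (nat \<lfloor>x\<rfloor>) \<le> \<epsilon> * x" using elim(2) \<epsilon> by (intro mult_left_mono) auto
      with elim(1) show ?case
        unfolding interval norm_of_real abs_of_nonneg[OF elim(2)] by linarith
    qed
  qed
qed

section \<open>Katai's orthogonality criterion\<close>

lemma nonsummable_large_sum:
  fixes u :: "nat \<Rightarrow> real"
  assumes "\<And>p. p \<in> P \<Longrightarrow> u p \<ge> 0" and "\<not> u summable_on P"
  obtains F where "finite F" "F \<subseteq> P" "(\<Sum>p\<in>F. u p) \<ge> B"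
proof -
  have "\<not> bdd_above (sum u ` {F. F \<subseteq> P \<and> finite F})"
    using assms nonneg_bdd_above_summable_on[of P u] by blast
  hence "\<exists>F. F \<subseteq> P \<and> finite F \<and> \<not> (\<Sum>p\<in>F. u p) \<le> B"
    unfolding bdd_above_def by blast
  thus ?thesis using that by fastforce
qed

text \<open>
  After exchanging the sums, \<open>h m\<close> multiplies an inner sum over those \<open>p\<close> with \<open>p * m \<le> N\<close>, so
  the Cauchy--Schwarz inequality removes it. Squaring the inner sum produces correlations of \<open>a\<close>
  along the multiples of \<open>p\<close> and of \<open>q\<close>, cut off at \<open>N div max p q\<close>.
\<close>
lemma bilinear_sum_bound:
  fixes L :: real
  assumes fin: "finite P" and prime: "\<And>p. p \<in> P \<Longrightarrow> prime p"
    and a: "\<And>n. n \<ge> 1 \<Longrightarrow> norm (a n) \<le> A"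
    and orth: "\<And>p q. p \<in> P \<Longrightarrow> q \<in> P \<Longrightarrow> p \<noteq> q \<Longrightarrow> zero_mean (\<lambda>n. a (p * n) * cnj (a (q * n)))"
    and c: "\<And>p. p \<in> P \<Longrightarrow> norm (c p) \<le> 1" and h: "\<And>m. m \<ge> 1 \<Longrightarrow> norm (h m) \<le> 1"
  defines "L \<equiv> \<Sum>p\<in>P. 1 / real p"
  assumes L: "L > 0"
  shows "\<forall>\<^sub>F N in sequentially.
    norm (\<Sum>p\<in>P. \<Sum>m=1..N div p. c p * h m * a (p * m)) \<le> N * sqrt ((A\<^sup>2 + 1) * L)"
proof -
  \<comment> \<open>Each of the at most \<open>(card P)\<^sup>2\<close> off-diagonal correlations is allowed an equal share of \<open>N * L\<close>.\<close>
  define \<eta> where "\<eta> = L / (real (card P))\<^sup>2"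
  have card: "card P > 0" using L fin by (auto simp: L_def card_gt_0_iff)
  have \<eta>: "\<eta> > 0" using L card by (simp add: \<eta>_def)
  have P0: "p > 0" if "p \<in> P" for p using prime[OF that] by (simp add: prime_gt_0_nat)
  have "\<forall>\<^sub>F N in sequentially.
      norm (\<Sum>m=1..N div max p q. a (p * m) * cnj (a (q * m))) \<le> \<eta> * real N"
    if pq: "p \<in> P" "q \<in> P" "p \<noteq> q" for p q
  proof -
    have lim: "filterlim (\<lambda>N. N div max p q) sequentially sequentially"
      using P0[OF pq(1)] unfolding filterlim_at_top
    proof (intro allI eventually_sequentiallyI)
      fix Z N :: nat assume "Z * max p q \<le> N"
      thus "Z \<le> N div max p q" using P0[OF pq(1)]
        by (simp add: less_eq_div_iff_mult_less_eq max_def)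
    qed
    have "\<forall>\<^sub>F N in sequentially.
        norm (\<Sum>m=1..N div max p q. a (p * m) * cnj (a (q * m))) \<le> \<eta> * real (N div max p q)"
      by (rule eventually_compose_filterlim[OF zero_meanD[OF orth[OF pq] \<eta>] lim])
    thus ?thesis
    proof eventually_elim
      case (elim N)
      have "\<eta> * real (N div max p q) \<le> \<eta> * N" using \<eta> by (intro mult_left_mono) auto
      with elim show ?case by linarith
    qed
  qed
  hence "\<forall>\<^sub>F N in sequentially. \<forall>p\<in>P. \<forall>q\<in>P. p \<noteq> q \<longrightarrow>
      norm (\<Sum>m=1..N div max p q. a (p * m) * cnj (a (q * m))) \<le> \<eta> * real N"
    by (intro eventually_ball_finite ballI fin) (auto simp: eventually_mono)
  thus ?thesis
  proof eventually_elim
    case (elim N)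
    define y where "y m = (\<Sum>p\<in>P. if p * m \<le> N then c p * a (p * m) else 0)" for m
    have trunc: "(\<Sum>m=1..N. if d * m \<le> N then b m else 0) = (\<Sum>m=1..N div d. b m)"
      if "d > 0" for d and b :: "nat \<Rightarrow> complex"
    proof -
      have "(\<Sum>m=1..N. if d * m \<le> N then b m else 0) = (\<Sum>m\<in>{m\<in>{1..N}. d * m \<le> N}. b m)"
        by (subst sum.inter_filter) auto
      also have "{m\<in>{1..N}. d * m \<le> N} = {1..N div d}"
        using that by (auto simp: less_eq_div_iff_mult_less_eq mult.commute)
                      (meson div_le_dividend le_trans less_eq_div_iff_mult_less_eq)
      finally show ?thesis .
    qed
    have "(\<Sum>p\<in>P. \<Sum>m=1..N div p. c p * h m * a (p * m))
        = (\<Sum>p\<in>P. \<Sum>m=1..N. if p * m \<le> N then c p * h m * a (p * m) else 0)"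
      using P0 by (intro sum.cong refl trunc[symmetric]) auto
    also have "\<dots> = (\<Sum>m=1..N. h m * y m)"
      unfolding y_def sum_distrib_left by (subst sum.swap) (auto intro!: sum.cong)
    also have "norm \<dots> \<le> (\<Sum>m=1..N. norm (y m))"
      by (intro sum_norm_le) (auto simp: norm_mult intro!: mult_left_le_one_le h)
    also have "\<dots> \<le> sqrt (N * (\<Sum>m=1..N. (norm (y m))\<^sup>2))"
      by (rule sum_le_sqrt_sum_squares)
    also have "\<dots> \<le> sqrt (N * (N * ((A\<^sup>2 + 1) * L)))"
    proof (intro real_sqrt_le_mono mult_left_mono)
      have "complex_of_real (\<Sum>m=1..N. (norm (y m))\<^sup>2) = (\<Sum>m=1..N. y m * cnj (y m))"
        by (simp only: of_real_sum complex_norm_square)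
      also have "\<dots> = (\<Sum>m=1..N. \<Sum>p\<in>P. \<Sum>q\<in>P. if max p q * m \<le> N
                        then c p * cnj (c q) * (a (p * m) * cnj (a (q * m))) else 0)"
        unfolding y_def cnj_sum sum_product
        by (intro sum.cong refl) (auto simp: nat_mult_max_left)
      also have "\<dots> = (\<Sum>p\<in>P. \<Sum>m=1..N. \<Sum>q\<in>P. if max p q * m \<le> N
                        then c p * cnj (c q) * (a (p * m) * cnj (a (q * m))) else 0)"
        by (rule sum.swap)
      also have "\<dots> = (\<Sum>p\<in>P. \<Sum>q\<in>P. \<Sum>m=1..N. if max p q * m \<le> N
                        then c p * cnj (c q) * (a (p * m) * cnj (a (q * m))) else 0)"
        by (intro sum.cong refl sum.swap)
      also have "\<dots> = (\<Sum>p\<in>P. \<Sum>q\<in>P. c p * cnj (c q) *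
                        (\<Sum>m=1..N div max p q. a (p * m) * cnj (a (q * m))))"
        unfolding sum_distrib_left using P0 by (intro sum.cong refl trunc) (auto simp: max_def)
      finally have "norm (complex_of_real (\<Sum>m=1..N. (norm (y m))\<^sup>2))
          = norm (\<Sum>p\<in>P. \<Sum>q\<in>P. c p * cnj (c q) *
                    (\<Sum>m=1..N div max p q. a (p * m) * cnj (a (q * m))))"
        by (rule arg_cong)
      hence "(\<Sum>m=1..N. (norm (y m))\<^sup>2) = norm (\<Sum>p\<in>P. \<Sum>q\<in>P. c p * cnj (c q) *
                        (\<Sum>m=1..N div max p q. a (p * m) * cnj (a (q * m))))"
        unfolding norm_of_real by (subst (asm) abs_of_nonneg) (auto intro: sum_nonneg)
      also have "\<dots> \<le> (\<Sum>p\<in>P. \<Sum>q\<in>P. (if q = p then A\<^sup>2 * N / p else 0) + \<eta> * N)"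
      proof (intro sum_norm_le)
        fix p q assume pq: "p \<in> P" "q \<in> P"
        have "norm (c p * cnj (c q) * (\<Sum>m=1..N div max p q. a (p * m) * cnj (a (q * m))))
            \<le> 1 * 1 * norm (\<Sum>m=1..N div max p q. a (p * m) * cnj (a (q * m)))"
          unfolding norm_mult complex_mod_cnj using c pq by (intro mult_mono) auto
        also have "\<dots> \<le> (if q = p then A\<^sup>2 * N / p else 0) + \<eta> * N"
        proof (cases "q = p")
          case True
          have "norm (\<Sum>m=1..N div p. a (p * m) * cnj (a (p * m))) \<le> real (card {1..N div p}) * A\<^sup>2"
            using a P0[OF pq(1)]
            by (intro sum_norm_bound)
               (auto simp: norm_mult power2_eq_square Suc_le_eq intro!: mult_mono intro: order_trans[OF norm_ge_zero])
          also have "\<dots> \<le> (real N / p) * A\<^sup>2"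
            by (intro mult_right_mono) (auto intro: of_nat_div_le_of_nat)
          finally show ?thesis using True \<eta> by (simp add: mult.commute add_increasing2)
        next
          case False
          thus ?thesis using elim pq by auto
        qed
        finally show "norm (c p * cnj (c q) * (\<Sum>m=1..N div max p q. a (p * m) * cnj (a (q * m))))
            \<le> (if q = p then A\<^sup>2 * N / p else 0) + \<eta> * N" .
      qed
      also have "\<dots> = A\<^sup>2 * N * L + \<eta> * N * (real (card P))\<^sup>2"
        using fin by (simp add: sum.distrib L_def sum_distrib_left power2_eq_square)
      also have "\<dots> = N * ((A\<^sup>2 + 1) * L)"
        using card by (simp add: \<eta>_def algebra_simps)
      finally show "(\<Sum>m=1..N. (norm (y m))\<^sup>2) \<le> N * ((A\<^sup>2 + 1) * L)" .
    qed auto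
    also have "\<dots> = N * sqrt ((A\<^sup>2 + 1) * L)"
      by (simp add: real_sqrt_mult)
    finally show ?case .
  qed
qed

lemma sum_inverse_squares_le:
  assumes "finite P"
  shows "(\<Sum>p\<in>P. 1 / (real p)\<^sup>2) \<le> 2"
proof -
  obtain M where M: "P \<subseteq> {..M}" using assms finite_nat_iff_bounded_le by blast
  have "(\<Sum>p\<in>P. 1 / (real p)\<^sup>2) \<le> (\<Sum>p\<le>M. 1 / (real p)\<^sup>2)"
    using M by (intro sum_mono2) auto
  \<comment> \<open>For \<open>M = 0\<close> both sides use \<open>1 / 0 = 0\<close>.\<close>
  also have "\<dots> \<le> 2 - 1 / real M"
  proof (induction M)
    case (Suc M)
    show ?case
    proof (cases "M = 0")
      case False
      have "1 / (real (Suc M))\<^sup>2 \<le> 1 / (real M * real (Suc M))"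
        using False by (intro divide_left_mono) (auto simp: power2_eq_square)
      also have "\<dots> = 1 / real M - 1 / real (Suc M)"
        using False by (simp add: field_simps)
      finally show ?thesis using Suc by simp
    qed simp
  qed simp
  also have "\<dots> \<le> 2" by simp
  finally show ?thesis .
qed

text \<open>
  Katai's criterion. The factorisation of \<open>g\<close> fails on the multiples \<open>p * m\<close> with \<open>p dvd m\<close>;
  these have total density at most the sum of the \<open>1 / p\<^sup>2\<close>, which stays bounded while the main term
  grows like \<open>\<surd>L\<close>.
\<close>
lemma katai_criterion:
  assumes a: "\<And>n. n \<ge> 1 \<Longrightarrow> norm (a n) \<le> A"
    and orth: "\<And>p q. prime p \<Longrightarrow> prime q \<Longrightarrow> p \<noteq> q \<Longrightarrow> zero_mean (\<lambda>n. a (p * n) * cnj (a (q * n)))"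
    and P: "\<And>p. p \<in> P \<Longrightarrow> prime p" "\<not> (\<lambda>p. 1 / real p) summable_on P"
    and g: "\<And>n. n \<ge> 1 \<Longrightarrow> norm (g n) \<le> 1"
    and factor: "\<And>p m. p \<in> P \<Longrightarrow> m \<ge> 1 \<Longrightarrow> \<not> p dvd m \<Longrightarrow> g (p * m) = c p * h m"
    and c: "\<And>p. p \<in> P \<Longrightarrow> norm (c p) \<le> 1" and h: "\<And>m. m \<ge> 1 \<Longrightarrow> norm (h m) \<le> 1"
  shows "zero_mean (\<lambda>n. g n * a n)"
  unfolding zero_mean_def
proof (intro allI impI)
  fix \<epsilon> :: real assume \<epsilon>: "\<epsilon> > 0"
  have A: "A \<ge> 0" using a[of 1] norm_ge_zero[of "a 1"] by linarith
  \<comment> \<open>The three terms come from \<open>turan_kubilius_dual\<close>, from the multiples with \<open>p dvd m\<close> and from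
    the bilinear sum; for \<open>L \<ge> 1\<close> their total is at most \<open>K * N * sqrt L\<close>.\<close>
  define K where "K = A * sqrt 2 + 4 * A + sqrt (A\<^sup>2 + 1)"
  have K: "K > 0" using A by (simp add: K_def add_nonneg_pos pos_add_strict)
  obtain F where F: "finite F" "F \<subseteq> P" and large: "(\<Sum>p\<in>F. 1 / real p) \<ge> max 1 ((K / \<epsilon>)\<^sup>2)"
    using nonsummable_large_sum[OF _ P(2)] by (metis of_nat_0_le_iff divide_nonneg_nonneg zero_le_one)
  define L where "L = (\<Sum>p\<in>F. 1 / real p)"
  have L: "L \<ge> 1" "(K / \<epsilon>)\<^sup>2 \<le> L" using large by (auto simp: L_def)
  have prime: "prime p" if "p \<in> F" for p using that F P by auto
  have P0: "p > 0" if "p \<in> F" for p using prime[OF that] by (simp add: prime_gt_0_nat)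
  have bilinear: "\<forall>\<^sub>F N in sequentially.
      norm (\<Sum>p\<in>F. \<Sum>m=1..N div p. c p * h m * a (p * m)) \<le> N * sqrt ((A\<^sup>2 + 1) * L)"
    unfolding L_def
    by (rule bilinear_sum_bound[OF F(1) prime a]) (use F orth prime c h L in \<open>auto simp: L_def\<close>)
  have "\<forall>\<^sub>F N in sequentially. N \<ge> 2 * card F" by (rule eventually_ge_at_top)
  with bilinear show "\<forall>\<^sub>F N in sequentially. norm (\<Sum>n=1..N. g n * a n) \<le> \<epsilon> * real N"
  proof eventually_elim
    case (elim N)
    let ?S = "\<Sum>n=1..N. g n * a n"
    let ?T = "\<Sum>p\<in>F. \<Sum>m=1..N div p. g (p * m) * a (p * m)"
    let ?U = "\<Sum>p\<in>F. \<Sum>m=1..N div p. c p * h m * a (p * m)"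
    have ga: "norm (g n * a n) \<le> A" if "n \<ge> 1" for n
      using mult_mono[OF g[OF that] a[OF that]] by (simp add: norm_mult)
    have ST: "norm (of_real L * ?S - ?T) \<le> A * (N * sqrt (2 * L))"
      using turan_kubilius_dual[where P = F and w = "\<lambda>_. 1" and b = "\<lambda>n. g n * a n" and N = N and B = A,
              OF F(1) prime] ga elim(2)
      by (simp add: L_def)
    have TU: "norm (?T - ?U) \<le> 4 * A * N"
    proof -
      have "norm (?T - ?U) = norm (\<Sum>p\<in>F. \<Sum>m=1..N div p. (g (p * m) - c p * h m) * a (p * m))"
        by (simp add: sum_subtractf algebra_simps)
      also have "\<dots> \<le> (\<Sum>p\<in>F. \<Sum>m=1..N div p. if p dvd m then 2 * A else 0)"
      proof (intro sum_norm_le)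
        fix p m assume p: "p \<in> F" and m: "m \<in> {1..N div p}"
        have pm: "p * m \<ge> 1" using P0[OF p] m by (simp add: Suc_le_eq)
        show "norm ((g (p * m) - c p * h m) * a (p * m)) \<le> (if p dvd m then 2 * A else 0)"
        proof (cases "p dvd m")
          case True
          have "norm (c p * h m) \<le> 1 * 1"
            unfolding norm_mult using c h m p F by (intro mult_mono) auto
          hence "norm (g (p * m) - c p * h m) \<le> 2"
            using norm_triangle_ineq4[of "g (p * m)" "c p * h m"] g[OF pm] by linarith
          hence "norm (g (p * m) - c p * h m) * norm (a (p * m)) \<le> 2 * A"
            using a[OF pm] by (intro mult_mono) auto
          thus ?thesis using True by (simp add: norm_mult)
        next
          case False
          thus ?thesis using factor[of p m] p m F by auto
        qed
      qed
      also have "\<dots> = (\<Sum>p\<in>F. 2 * A * (N div p div p))"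
        using P0 sum_over_multiples[where b = "\<lambda>_. 2 * A"]
        by (intro sum.cong refl) (simp add: Suc_le_eq)
      also have "\<dots> \<le> (\<Sum>p\<in>F. 2 * A * (N * (1 / (real p)\<^sup>2)))"
      proof (intro sum_mono mult_left_mono)
        fix p
        have "real (N div p div p) \<le> real N / real (p * p)"
          unfolding div_mult2_eq[symmetric] by (rule of_nat_div_le_of_nat)
        thus "real (N div p div p) \<le> N * (1 / (real p)\<^sup>2)" by (simp add: power2_eq_square)
      qed (use A in auto)
      also have "\<dots> = 2 * A * N * (\<Sum>p\<in>F. 1 / (real p)\<^sup>2)" by (simp add: sum_distrib_left mult_ac)
      also have "\<dots> \<le> 2 * A * N * 2"
        using A by (intro mult_left_mono sum_inverse_squares_le F) auto
      finally show ?thesis by simp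
    qed
    have "L * norm ?S = norm ((of_real L * ?S - ?T) + (?T - ?U) + ?U)"
      using L by (simp add: norm_mult)
    also have "\<dots> \<le> norm (of_real L * ?S - ?T) + norm (?T - ?U) + norm ?U"
      by (intro norm_triangle_mono) auto
    also have "\<dots> \<le> A * (N * sqrt (2 * L)) + 4 * A * N + N * sqrt ((A\<^sup>2 + 1) * L)"
      using ST TU elim(1) by linarith
    also have "\<dots> \<le> A * (N * sqrt (2 * L)) + 4 * A * N * sqrt L + N * sqrt ((A\<^sup>2 + 1) * L)"
      using mult_left_mono[of 1 "sqrt L" "4 * A * N"] L A by simp
    also have "\<dots> = (K * sqrt L) * N" unfolding K_def real_sqrt_mult by (simp add: algebra_simps)
    also have "\<dots> \<le> (\<epsilon> * L) * N"
    proof (intro mult_right_mono)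
      have "K / \<epsilon> \<le> sqrt L" using L K \<epsilon> by (intro real_le_rsqrt) auto
      hence "K \<le> \<epsilon> * sqrt L" using \<epsilon> by (simp add: field_simps)
      from mult_right_mono[OF this, of "sqrt L"] L show "K * sqrt L \<le> \<epsilon> * L"
        by (simp add: mult.assoc)
    qed auto
    finally have "L * norm ?S \<le> L * (\<epsilon> * N)" by (simp add: mult_ac)
    thus ?case using L by simp
  qed
qed

section \<open>Multiplicative functions with nonzero mean modulus\<close>

lemma mult_unit_discD:
  assumes "f \<in> mult_unit_disc"
  shows "f 1 = 1" "m \<ge> 1 \<Longrightarrow> n \<ge> 1 \<Longrightarrow> coprime m n \<Longrightarrow> f (m * n) = f m * f n"
    "n \<ge> 1 \<Longrightarrow> norm (f n) \<le> 1"
  using assms by (auto simp: mult_unit_disc_def multiplicative_fun_def)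

lemma norm_le_prod_exact_primes:
  assumes f: "f \<in> mult_unit_disc" and "finite S" and "n \<ge> 1"
    and "\<And>p. p \<in> S \<Longrightarrow> prime p" "\<And>p. p \<in> S \<Longrightarrow> p dvd n" "\<And>p. p \<in> S \<Longrightarrow> \<not> p\<^sup>2 dvd n"
  shows "norm (f n) \<le> (\<Prod>p\<in>S. norm (f p))"
  using assms(2-)
proof (induction S arbitrary: n)
  case empty
  thus ?case using mult_unit_discD[OF f] by simp
next
  case (insert p S)
  from insert.prems have p: "prime p" "p dvd n" "\<not> p\<^sup>2 dvd n" by auto
  then obtain m where n: "n = p * m" by blast
  have pm: "\<not> p dvd m" using p n by (auto simp: power2_eq_square)
  have m: "m \<ge> 1" using insert.prems n by (auto simp: Suc_le_eq intro!: Nat.gr0I)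
  have "norm (f m) \<le> (\<Prod>q\<in>S. norm (f q))"
  proof (rule insert.IH[OF m])
    fix q assume q: "q \<in> S"
    hence "prime q" "q dvd p * m" "q \<noteq> p" using insert.prems insert.hyps n by auto
    thus "prime q" "q dvd m" using p by (auto simp: prime_dvd_mult_iff primes_dvd_imp_eq)
    show "\<not> q\<^sup>2 dvd m" using insert.prems(4)[of q] q n by auto
  qed
  hence "norm (f p) * norm (f m) \<le> norm (f p) * (\<Prod>q\<in>S. norm (f q))"
    by (intro mult_left_mono) auto
  moreover have "f n = f p * f m"
    using mult_unit_discD(2)[OF f, of p m] p(1) m pm n
    by (simp add: prime_imp_coprime prime_gt_0_nat Suc_le_eq)
  ultimately show ?case using insert.hyps by (simp add: norm_mult)
qed

text \<open>
  With \<open>y = (\<Sum>p\<in>S. 1 - norm (f p))\<close> the factors of \<open>f n\<close> at the primes of \<open>S\<close> have product at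
  most \<open>exp (- y)\<close>, and \<open>y * exp (- y) \<le> 1\<close>.
\<close>
lemma norm_mult_sum_exact_primes_le:
  assumes f: "f \<in> mult_unit_disc" and "finite S" and "n \<ge> 1"
    and "\<And>p. p \<in> S \<Longrightarrow> prime p" "\<And>p. p \<in> S \<Longrightarrow> p dvd n" "\<And>p. p \<in> S \<Longrightarrow> \<not> p\<^sup>2 dvd n"
  shows "norm (f n) * (\<Sum>p\<in>S. 1 - norm (f p)) \<le> 1"
proof -
  define y where "y = (\<Sum>p\<in>S. 1 - norm (f p))"
  have y: "y \<ge> 0" unfolding y_def
    using assms(4) mult_unit_discD(3)[OF f]
    by (intro sum_nonneg) (simp add: prime_gt_0_nat Suc_le_eq)
  have "norm (f n) \<le> (\<Prod>p\<in>S. norm (f p))" by (rule norm_le_prod_exact_primes[OF assms])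
  also have "\<dots> \<le> (\<Prod>p\<in>S. exp (- (1 - norm (f p))))"
  proof (intro prod_mono conjI)
    fix p
    show "norm (f p) \<le> exp (- (1 - norm (f p)))"
      using exp_ge_add_one_self[of "norm (f p) - 1"] by simp
  qed auto
  also have "\<dots> = exp (- y)" using \<open>finite S\<close> by (simp add: y_def exp_sum sum_negf[symmetric])
  finally have le: "norm (f n) \<le> exp (- y)" .
  have "y \<le> exp y" using exp_ge_add_one_self[of y] by linarith
  with le have "norm (f n) * y \<le> exp (- y) * exp y" using y by (intro mult_mono) auto
  thus ?thesis by (simp add: y_def flip: exp_add)
qed

text \<open>
  Turan--Kubilius with the weights \<open>1 - norm (f p)\<close> compares the left-hand side with the sum of
  \<open>weighted_omega F w n * norm (f n)\<close>. The primes that divide \<open>n\<close> exactly once contribute at most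
  \<open>1\<close> for each \<open>n\<close>, and the others at most \<open>2\<close> on average over \<open>n\<close>; together they give the
  constant \<open>3\<close>.
\<close>
lemma mean_norm_bound:
  fixes L :: real and N :: nat
  assumes f: "f \<in> mult_unit_disc" and fin: "finite F" and prime: "\<And>p. p \<in> F \<Longrightarrow> prime p"
    and N: "N \<ge> 2 * card F"
  defines "L \<equiv> \<Sum>p\<in>F. (1 - norm (f p)) / real p"
  shows "L * (\<Sum>n=1..N. norm (f n)) \<le> N * (sqrt (2 * L) + 3)"
proof -
  define w where "w p = 1 - norm (f p)" for p
  have pos: "p > 0" if "p \<in> F" for p using prime[OF that] by (simp add: prime_gt_0_nat)
  have w: "0 \<le> w p" "w p \<le> 1" if "p \<in> F" for p
    using mult_unit_discD(3)[OF f, of p] pos[OF that] by (auto simp: w_def Suc_le_eq)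
  have "norm (of_real L * (\<Sum>n=1..N. norm (f n)) - (\<Sum>p\<in>F. of_real (w p) * (\<Sum>m=1..N div p. norm (f (p * m)))))
      \<le> 1 * (N * sqrt (2 * L))"
    unfolding L_def w_def[symmetric]
    by (rule turan_kubilius_dual[OF fin prime w _ N]) (auto intro: mult_unit_discD(3)[OF f])
  moreover have "(\<Sum>p\<in>F. of_real (w p) * (\<Sum>m=1..N div p. norm (f (p * m)))) \<le> 3 * real N"
  proof -
    have "(\<Sum>p\<in>F. of_real (w p) * (\<Sum>m=1..N div p. norm (f (p * m))))
        = (\<Sum>n=1..N. weighted_omega F w n * norm (f n))"
      using sum_weighted_omega[OF pos, where P = F and w = w and N = N and b = "\<lambda>n. norm (f n)"] by simp
    also have "\<dots> \<le> (\<Sum>n=1..N. 1 + (\<Sum>p\<in>F. if p\<^sup>2 dvd n then 1 else 0))"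
    proof (intro sum_mono)
      fix n assume "n \<in> {1..N}"
      hence n: "n \<ge> 1" by simp
      define S where "S = {p \<in> F. p dvd n \<and> \<not> p\<^sup>2 dvd n}"
      have "weighted_omega F w n
          \<le> (\<Sum>p\<in>F. (if p dvd n \<and> \<not> p\<^sup>2 dvd n then w p else 0) + (if p\<^sup>2 dvd n then 1 else 0))"
        unfolding weighted_omega_def using w by (intro sum_mono) auto
      also have "\<dots> = (\<Sum>p\<in>S. w p) + (\<Sum>p\<in>F. if p\<^sup>2 dvd n then 1 else 0)"
        using fin by (simp add: sum.distrib S_def sum.inter_filter)
      finally have "weighted_omega F w n * norm (f n)
          \<le> ((\<Sum>p\<in>S. w p) + (\<Sum>p\<in>F. if p\<^sup>2 dvd n then 1 else 0)) * norm (f n)"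
        by (rule mult_right_mono) simp
      also have "\<dots> = norm (f n) * (\<Sum>p\<in>S. w p) + (\<Sum>p\<in>F. if p\<^sup>2 dvd n then 1 else 0) * norm (f n)"
        by (simp add: algebra_simps)
      also have "\<dots> \<le> 1 + (\<Sum>p\<in>F. if p\<^sup>2 dvd n then 1 else 0) * 1"
        unfolding w_def using fin prime n mult_unit_discD(3)[OF f n]
        by (intro add_mono norm_mult_sum_exact_primes_le[OF f] mult_left_mono sum_nonneg) (auto simp: S_def)
      finally show "weighted_omega F w n * norm (f n) \<le> 1 + (\<Sum>p\<in>F. if p\<^sup>2 dvd n then 1 else 0)"
        by simp
    qed
    also have "\<dots> = real N + (\<Sum>p\<in>F. \<Sum>n=1..N. if p\<^sup>2 dvd n then 1 else 0)"
      by (simp add: sum.distrib) (rule sum.swap)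
    also have "(\<Sum>p\<in>F. \<Sum>n=1..N. if p\<^sup>2 dvd n then 1 else 0) = (\<Sum>p\<in>F. real (N div p\<^sup>2))"
      using pos sum_over_multiples[where b = "\<lambda>_. 1 :: real" and N = N]
      by (intro sum.cong refl) (simp add: Suc_le_eq)
    also have "\<dots> \<le> (\<Sum>p\<in>F. N * (1 / (real p)\<^sup>2))"
      by (intro sum_mono order_trans[OF of_nat_div_le_of_nat]) simp
    also have "\<dots> = N * (\<Sum>p\<in>F. 1 / (real p)\<^sup>2)" by (simp add: sum_distrib_left)
    also have "\<dots> \<le> real N * 2" by (intro mult_left_mono sum_inverse_squares_le fin) auto
    finally show ?thesis by simp
  qed
  ultimately show ?thesis by (simp add: abs_le_iff algebra_simps)
qed

text \<open>
  If the series diverges, then \<open>L\<close> in the previous bound can be made arbitrarily large, and the mean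
  of \<open>norm \<circ> f\<close> is \<open>O(1/\<surd>L)\<close>.
\<close>
lemma norm1_nonzero_imp_summable:
  assumes f: "f \<in> mult_unit_disc" and nz: "norm1 f \<noteq> 0"
  shows "(\<lambda>p. (1 - norm (f p)) / real p) summable_on {p. prime p}"
proof (rule ccontr)
  assume nonsum: "\<not> (\<lambda>p. (1 - norm (f p)) / real p) summable_on {p. prime p}"
  have nonneg: "(1 - norm (f p)) / real p \<ge> 0" if "p \<in> {p. prime p}" for p
    using mult_unit_discD(3)[OF f, of p] that by (simp add: prime_gt_0_nat Suc_le_eq)
  have "norm1 f \<le> 0 + ereal \<epsilon>" if \<epsilon>: "\<epsilon> > 0" for \<epsilon>
  proof -
    obtain F where F: "finite F" "F \<subseteq> {p. prime p}"
      and large: "(\<Sum>p\<in>F. (1 - norm (f p)) / real p) \<ge> max 1 ((5 / \<epsilon>)\<^sup>2)"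
      using nonsummable_large_sum[OF nonneg nonsum] by metis
    define L where "L = (\<Sum>p\<in>F. (1 - norm (f p)) / real p)"
    have L: "L \<ge> 1" "(5 / \<epsilon>)\<^sup>2 \<le> L" using large by (auto simp: L_def)
    have "\<forall>\<^sub>F N in sequentially. N \<ge> max 1 (2 * card F)" by (rule eventually_ge_at_top)
    hence "\<forall>\<^sub>F N in sequentially. ereal ((\<Sum>n=1..N. norm (f n)) / real N) \<le> ereal \<epsilon>"
    proof eventually_elim
      case (elim N)
      have "L * (\<Sum>n=1..N. norm (f n)) \<le> N * (sqrt (2 * L) + 3)"
        unfolding L_def using F elim by (intro mean_norm_bound[OF f]) auto
      also have "\<dots> \<le> N * (2 * sqrt L + 3 * sqrt L)"
      proof (intro mult_left_mono add_mono)
        show "sqrt (2 * L) \<le> 2 * sqrt L"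
          using L real_sqrt_le_mono[of 2 4] by (simp add: real_sqrt_mult)
      qed (use L in auto)
      also have "\<dots> = N * (5 * sqrt L)" by simp
      also have "\<dots> \<le> N * (\<epsilon> * L)"
      proof (intro mult_left_mono)
        have "5 / \<epsilon> \<le> sqrt L" using L \<epsilon> by (intro real_le_rsqrt) auto
        hence "5 \<le> \<epsilon> * sqrt L" using \<epsilon> by (simp add: field_simps)
        from mult_right_mono[OF this, of "sqrt L"] L show "5 * sqrt L \<le> \<epsilon> * L"
          by (simp add: mult.assoc)
      qed auto
      finally have "L * (\<Sum>n=1..N. norm (f n)) \<le> L * (\<epsilon> * N)" by (simp add: mult_ac)
      thus ?case using L elim by (simp add: divide_le_eq)
    qed
    thus ?thesis unfolding norm1_def by (simp add: Limsup_bounded)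
  qed
  hence "norm1 f \<le> 0" by (rule ereal_le_epsilon2)
  moreover have "norm1 f \<ge> 0" unfolding norm1_def
    by (intro le_Limsup always_eventually allI) (auto intro!: divide_nonneg_nonneg sum_nonneg)
  ultimately show False using nz by simp
qed

section \<open>Comparing a multiplicative function with its support\<close>

text \<open>
  The difference of two products of numbers in \<open>[0, 1]\<close> is at most the sum of the differences of the
  factors. Splitting off one prime power after another gives the sum over the prime powers that
  exactly divide \<open>n\<close>. The terms are nonnegative, so all prime powers dividing \<open>n\<close> may be allowed;
  this makes the sum over \<open>n\<close> easy to evaluate.
\<close>
lemma multiplicative_diff_le:
  fixes u v :: "nat \<Rightarrow> real"
  assumes one: "u 1 = 1" "v 1 = 1"
    and mult: "\<And>m n. m \<ge> 1 \<Longrightarrow> n \<ge> 1 \<Longrightarrow> coprime m n \<Longrightarrow> u (m * n) = u m * u n"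
      "\<And>m n. m \<ge> 1 \<Longrightarrow> n \<ge> 1 \<Longrightarrow> coprime m n \<Longrightarrow> v (m * n) = v m * v n"
    and bounds: "\<And>n. n \<ge> 1 \<Longrightarrow> 0 \<le> v n" "\<And>n. n \<ge> 1 \<Longrightarrow> v n \<le> u n" "\<And>n. n \<ge> 1 \<Longrightarrow> u n \<le> 1"
    and n: "n \<ge> 1"
  shows "u n - v n \<le> (\<Sum>q | primepow q \<and> q dvd n. u q - v q)"
  using n
proof (induction n rule: less_induct)
  case (less n)
  have nonneg: "v q \<le> u q" if "primepow q" for q
    using bounds(2)[of q] primepow_gt_Suc_0[OF that] by simp
  show ?case
  proof (cases "n = 1")
    case True
    have "0 \<le> (\<Sum>q | primepow q \<and> q dvd n. u q - v q)" by (intro sum_nonneg) (auto intro: nonneg)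
    thus ?thesis using one True by simp
  next
    case False
    then obtain p where p: "prime p" "p dvd n" using prime_factor_nat by blast
    define k where "k = multiplicity p n"
    have "n \<noteq> 0" "\<not> is_unit p" using less.prems p(1) by auto
    then obtain m where n: "n = p ^ k * m" and pm: "\<not> p dvd m"
      unfolding k_def by (rule multiplicity_decompose')
    have k: "k > 0" using n pm p(2) by (auto intro!: Nat.gr0I)
    have m: "m \<ge> 1" using n less.prems by (auto simp: Suc_le_eq intro!: Nat.gr0I)
    have pk: "p ^ k > 1" using prime_gt_1_nat[OF p(1)] k by (rule one_less_power)
    have "m < n" using n m pk by simp
    note IH = less.IH[OF this m]
    have fin: "finite {q. primepow q \<and> q dvd m}"
      by (rule finite_subset[of _ "{..m}"]) (use m in \<open>auto dest: dvd_imp_le\<close>)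
    have fin': "finite {q. primepow q \<and> q dvd n}"
      by (rule finite_subset[of _ "{..n}"]) (use less.prems in \<open>auto dest: dvd_imp_le\<close>)
    have new: "p ^ k \<notin> {q. primepow q \<and> q dvd m}"
      using pm k by (auto dest: dvd_trans[of p "p ^ k"] simp: dvd_power)
    have cop: "coprime (p ^ k) m" using p(1) pm by (simp add: prime_imp_coprime)
    have "u n - v n = (u (p ^ k) - v (p ^ k)) * u m + v (p ^ k) * (u m - v m)"
      using mult[of "p ^ k" m] pk m cop unfolding n by (simp add: algebra_simps)
    also have "\<dots> \<le> (u (p ^ k) - v (p ^ k)) * 1 + 1 * (u m - v m)"
      using bounds[of "p ^ k"] bounds[of m] pk m by (intro add_mono mult_left_mono mult_right_mono) auto
    also have "\<dots> \<le> (\<Sum>q \<in> insert (p ^ k) {q. primepow q \<and> q dvd m}. u q - v q)"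
      using IH fin new by simp
    also have "\<dots> \<le> (\<Sum>q | primepow q \<and> q dvd n. u q - v q)"
      using p(1) k n by (intro sum_mono2 fin') (auto intro: nonneg)
    finally show ?thesis .
  qed
qed

lemma sum_multiplicative_diff_le:
  fixes u v :: "nat \<Rightarrow> real"
  assumes one: "u 1 = 1" "v 1 = 1"
    and mult: "\<And>m n. m \<ge> 1 \<Longrightarrow> n \<ge> 1 \<Longrightarrow> coprime m n \<Longrightarrow> u (m * n) = u m * u n"
      "\<And>m n. m \<ge> 1 \<Longrightarrow> n \<ge> 1 \<Longrightarrow> coprime m n \<Longrightarrow> v (m * n) = v m * v n"
    and bounds: "\<And>n. n \<ge> 1 \<Longrightarrow> 0 \<le> v n" "\<And>n. n \<ge> 1 \<Longrightarrow> v n \<le> u n" "\<And>n. n \<ge> 1 \<Longrightarrow> u n \<le> 1"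
  shows "(\<Sum>n=1..N. u n - v n) \<le> N * (\<Sum>q\<le>N. if primepow q then (u q - v q) / q else 0)"
proof -
  define Q where "Q = {q. primepow q \<and> q \<le> N}"
  have Q: "finite Q" "\<And>q. q \<in> Q \<Longrightarrow> q > 0" by (auto simp: Q_def dest: primepow_gt_Suc_0)
  have "(\<Sum>n=1..N. u n - v n) \<le> (\<Sum>n=1..N. weighted_omega Q (\<lambda>q. u q - v q) n)"
  proof (intro sum_mono)
    fix n assume n: "n \<in> {1..N}"
    hence "u n - v n \<le> (\<Sum>q | primepow q \<and> q dvd n. u q - v q)"
      by (intro multiplicative_diff_le assms) auto
    also have "{q. primepow q \<and> q dvd n} = {q\<in>Q. q dvd n}"
      using n by (auto simp: Q_def dest: dvd_imp_le)
    also have "(\<Sum>q \<in> {q\<in>Q. q dvd n}. u q - v q) = weighted_omega Q (\<lambda>q. u q - v q) n"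
      using Q by (simp add: weighted_omega_def sum.inter_filter)
    finally show "u n - v n \<le> weighted_omega Q (\<lambda>q. u q - v q) n" .
  qed
  also have "\<dots> = (\<Sum>q\<in>Q. (u q - v q) * (N div q))"
    using sum_weighted_omega[OF Q(2), where P = Q and N = N and w = "\<lambda>q. u q - v q" and b = "\<lambda>_. 1 :: real"]
    by simp
  also have "\<dots> \<le> (\<Sum>q\<in>Q. (u q - v q) * (N / q))"
    using Q(2) bounds(2)
    by (intro sum_mono mult_left_mono of_nat_div_le_of_nat) (simp add: Suc_le_eq)
  also have "\<dots> = N * (\<Sum>q\<in>Q. (u q - v q) / q)"
    by (simp add: sum_distrib_left mult_ac)
  also have "(\<Sum>q\<in>Q. (u q - v q) / q) = (\<Sum>q\<le>N. if primepow q then (u q - v q) / q else 0)"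
    by (subst sum.inter_filter[symmetric]) (auto simp: Q_def intro!: sum.cong)
  finally show ?thesis .
qed

text \<open>
  For each base \<open>p\<close> the powers with exponent at least \<open>2\<close> form a geometric series of sum at most
  \<open>2 / p\<^sup>2\<close>.
\<close>
lemma sum_higher_primepow_reciprocals_le:
  "(\<Sum>q | q < N \<and> primepow q \<and> \<not> prime q. 1 / real q) \<le> 4"
proof -
  have geometric: "(\<Sum>j<M. x ^ (j + 2)) \<le> 2 * x\<^sup>2 - 2 * x ^ (M + 2)" if "0 \<le> x" "x \<le> 1 / 2" for x :: real and M
  proof (induction M)
    case (Suc M)
    have "2 * x ^ (Suc M + 2) \<le> x ^ (M + 2)"
      using mult_right_mono[of "2 * x" 1 "x ^ (M + 2)"] that by (simp add: mult.assoc)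
    with Suc show ?case by simp
  qed (simp add: power2_eq_square)
  have sub: "{q. q < N \<and> primepow q \<and> \<not> prime q} \<subseteq> (\<lambda>(p, j). p ^ (j + 2)) ` ({2..N} \<times> {..<N})"
  proof
    fix q assume "q \<in> {q. q < N \<and> primepow q \<and> \<not> prime q}"
    then obtain p k where q: "q < N" "\<not> prime q" "prime p" "k > 0" "q = p ^ k"
      by (auto simp: primepow_def)
    have "k \<noteq> 1" using q by auto
    with q(4) have "k \<ge> 2" by linarith
    then obtain j where k: "k = j + 2" by (metis add.commute le_Suc_ex)
    have p2: "p \<ge> 2" using q(3) by (rule prime_ge_2_nat)
    have "p \<le> q" using q(5) self_le_power[of p k] p2 q(4) by simp
    hence "p \<le> N" using q(1) by simp
    moreover have "j < N"
    proof -
      have "k < 2 ^ k" by (rule less_exp)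
      also have "(2::nat) ^ k \<le> p ^ k" using p2 by (rule power_mono) simp
      finally show ?thesis using q k by simp
    qed
    ultimately show "q \<in> (\<lambda>(p, j). p ^ (j + 2)) ` ({2..N} \<times> {..<N})"
      using q k p2 by (auto intro!: image_eqI[of _ _ "(p, j)"])
  qed
  have "(\<Sum>q | q < N \<and> primepow q \<and> \<not> prime q. 1 / real q)
      \<le> (\<Sum>q \<in> (\<lambda>(p, j). p ^ (j + 2)) ` ({2..N} \<times> {..<N}). 1 / real q)"
    by (intro sum_mono2 sub) auto
  also have "\<dots> \<le> (\<Sum>(p, j) \<in> {2..N} \<times> {..<N}. 1 / real (p ^ (j + 2)))"
    by (rule order_trans[OF sum_image_le]) (auto simp: case_prod_unfold o_def)
  also have "\<dots> = (\<Sum>p=2..N. \<Sum>j<N. (1 / real p) ^ (j + 2))"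
    by (simp add: sum.cartesian_product power_one_over)
  also have "\<dots> \<le> (\<Sum>p=2..N. 2 * (1 / (real p)\<^sup>2))"
  proof (intro sum_mono)
    fix p assume "p \<in> {2..N}"
    hence "(\<Sum>j<N. (1 / real p) ^ (j + 2)) \<le> 2 * (1 / real p)\<^sup>2 - 2 * (1 / real p) ^ (N + 2)"
      by (intro geometric) (auto simp: field_simps)
    also have "\<dots> \<le> 2 * (1 / (real p)\<^sup>2)" by (simp add: power_one_over)
    finally show "(\<Sum>j<N. (1 / real p) ^ (j + 2)) \<le> 2 * (1 / (real p)\<^sup>2)" .
  qed
  also have "\<dots> \<le> 4"
    using sum_inverse_squares_le[of "{2..N}"] by (simp only: sum_distrib_left[symmetric]) simp
  finally show ?thesis .
qed

lemma summable_over_primepows: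
  assumes f: "f \<in> mult_unit_disc"
    and sum: "(\<lambda>p. (1 - norm (f p)) / real p) summable_on {p. prime p}"
  shows "summable (\<lambda>q. if primepow q then (1 - norm (f q)) / real q else 0)"
proof (rule summableI_nonneg_bounded)
  have nonneg: "0 \<le> (1 - norm (f q)) / real q" "(1 - norm (f q)) / real q \<le> 1 / real q" if "primepow q" for q
    using mult_unit_discD(3)[OF f, of q] primepow_gt_Suc_0[OF that] by (auto intro!: divide_right_mono)
  thus "0 \<le> (if primepow q then (1 - norm (f q)) / real q else 0)" for q by simp
  fix N
  have "(\<Sum>q<N. if primepow q then (1 - norm (f q)) / real q else 0)
      = (\<Sum>q | q < N \<and> primepow q. (1 - norm (f q)) / real q)"
    by (subst sum.inter_filter[symmetric]) auto
  also have "{q. q < N \<and> primepow q} = {q. q < N \<and> prime q} \<union> {q. q < N \<and> primepow q \<and> \<not> prime q}"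
    by auto
  also have "(\<Sum>q\<in>\<dots>. (1 - norm (f q)) / real q)
      = (\<Sum>q | q < N \<and> prime q. (1 - norm (f q)) / real q)
        + (\<Sum>q | q < N \<and> primepow q \<and> \<not> prime q. (1 - norm (f q)) / real q)"
    by (intro sum.union_disjoint) auto
  also have "\<dots> \<le> (\<Sum>\<^sub>\<infinity>p | prime p. (1 - norm (f p)) / real p)
        + (\<Sum>q | q < N \<and> primepow q \<and> \<not> prime q. 1 / real q)"
    using nonneg by (intro add_mono sum_mono finite_sum_le_infsum sum) auto
  also have "\<dots> \<le> (\<Sum>\<^sub>\<infinity>p | prime p. (1 - norm (f p)) / real p) + 4"
    by (intro add_left_mono sum_higher_primepow_reciprocals_le)
  finally show "(\<Sum>q<N. if primepow q then (1 - norm (f q)) / real q else 0)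
      \<le> (\<Sum>\<^sub>\<infinity>p | prime p. (1 - norm (f p)) / real p) + 4" .
qed

text \<open>
  Dominated convergence in the form of Tannery's theorem, along \<open>s = 1 / (j + 1)\<close>. For \<open>s \<le> 1\<close> and
  values in the unit disc, \<open>norm z \<le> norm z powr s\<close>, so \<open>(1 - norm (f q)) / q\<close> dominates.
\<close>
lemma small_power_close_to_support:
  assumes f: "f \<in> mult_unit_disc"
    and sum: "(\<lambda>p. (1 - norm (f p)) / real p) summable_on {p. prime p}" and \<epsilon>: "\<epsilon> > 0"
  obtains s where "s > 0"
    "\<And>N. (\<Sum>n=1..N. of_bool (f n \<noteq> 0) - norm (f n) powr s) \<le> \<epsilon> * real N"
proof -
  define s where "s j = inverse (real (Suc j))" for j
  have s: "0 < s j" "s j \<le> 1" for j by (auto simp: s_def divide_simps)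
  define D where "D q j = (if primepow q then (of_bool (f q \<noteq> 0) - norm (f q) powr s j) / real q else 0)" for q j
  have upper: "norm (f n) powr s j \<le> of_bool (f n \<noteq> 0)" if "n \<ge> 1" for n j
    using powr_mono2[of "s j" "norm (f n)" 1] s[of j] mult_unit_discD(3)[OF f that] by auto
  have lower: "norm (f n) \<le> norm (f n) powr s j" if "n \<ge> 1" for n j
    using powr_mono'[of "s j" 1 "norm (f n)"] s[of j] mult_unit_discD(3)[OF f that] by auto
  have D: "0 \<le> D q j" "D q j \<le> (if primepow q then (1 - norm (f q)) / real q else 0)" for q j
  proof -
    have "q \<ge> 1" if "primepow q" using primepow_gt_Suc_0[OF that] by simp
    thus "0 \<le> D q j" "D q j \<le> (if primepow q then (1 - norm (f q)) / real q else 0)"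
      using upper[of q j] lower[of q j] by (auto simp: D_def intro!: divide_right_mono diff_mono)
  qed
  have lim: "(\<lambda>j. D q j) \<longlonglongrightarrow> 0" for q
  proof (cases "f q = 0")
    case False
    have "(\<lambda>j. norm (f q) powr s j) \<longlonglongrightarrow> norm (f q) powr 0"
      unfolding s_def using False by (intro tendsto_intros LIMSEQ_inverse_real_of_nat) auto
    from tendsto_mult_right[OF tendsto_diff[OF tendsto_const this], of 1 "1 / real q"]
    show ?thesis using False by (cases "primepow q") (simp_all add: D_def)
  next
    case True
    thus ?thesis by (cases "primepow q") (simp_all add: D_def)
  qed
  have "\<forall>\<^sub>F (q, j) in at_top \<times>\<^sub>F sequentially.
      norm (D q j) \<le> (if primepow q then (1 - norm (f q)) / real q else 0)"
  proof (intro always_eventually allI, unfold case_prod_unfold)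
    show "norm (D (fst x) (snd x))
        \<le> (if primepow (fst x) then (1 - norm (f (fst x))) / real (fst x) else 0)" for x
      using D[of "fst x" "snd x"] by simp
  qed
  from tannerys_theorem[OF lim this summable_over_primepows[OF f sum] sequentially_bot]
  have tannery: "(\<lambda>j. \<Sum>q. D q j) \<longlonglongrightarrow> (\<Sum>q. 0)"
    and summable: "\<forall>\<^sub>F j in sequentially. summable (\<lambda>q. norm (D q j))"
    by blast+
  have "\<forall>\<^sub>F j in sequentially. (\<Sum>q. D q j) < \<epsilon>"
    using order_tendstoD(2)[OF tannery, of \<epsilon>] \<epsilon> by simp
  with summable have "\<forall>\<^sub>F j in sequentially. summable (\<lambda>q. norm (D q j)) \<and> (\<Sum>q. D q j) < \<epsilon>"
    by eventually_elim auto
  then obtain j where j: "summable (\<lambda>q. norm (D q j))" "(\<Sum>q. D q j) < \<epsilon>"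
    using eventually_happens'[OF sequentially_bot] by blast
  have "(\<Sum>n=1..N. of_bool (f n \<noteq> 0) - norm (f n) powr s j) \<le> \<epsilon> * real N" for N
  proof -
    have "(\<Sum>n=1..N. of_bool (f n \<noteq> 0) - norm (f n) powr s j)
        \<le> N * (\<Sum>q\<le>N. if primepow q then (of_bool (f q \<noteq> 0) - norm (f q) powr s j) / q else 0)"
      using upper mult_unit_discD[OF f]
      by (intro sum_multiplicative_diff_le) (auto simp: norm_mult powr_mult)
    also have "\<dots> = N * (\<Sum>q\<le>N. D q j)" by (simp add: D_def)
    also have "\<dots> \<le> N * \<epsilon>"
    proof (intro mult_left_mono)
      have "(\<Sum>q\<le>N. D q j) \<le> (\<Sum>q. D q j)"
        using D(1) j(1) by (intro sum_le_suminf summable_norm_cancel[OF j(1)]) auto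
      thus "(\<Sum>q\<le>N. D q j) \<le> \<epsilon>" using j(2) by linarith
    qed auto
    finally show ?thesis by (simp add: mult.commute)
  qed
  with s(1)[of j] show ?thesis using that by blast
qed

text \<open>
  If the series converged, then \<open>f n = 1 / n\<close> would satisfy the hypotheses of
  \<open>small_power_close_to_support\<close>, and for some fixed \<open>s > 0\<close> the mean of \<open>1 - (1 / n) powr s\<close> would
  stay small. But \<open>(1 / n) powr s\<close> tends to \<open>0\<close>, so this mean tends to \<open>1\<close>.
\<close>
lemma not_summable_prime_reciprocals: "\<not> (\<lambda>p. 1 / real p) summable_on {p :: nat. prime p}"
proof
  assume sum: "(\<lambda>p. 1 / real p) summable_on {p :: nat. prime p}"
  define f :: "nat \<Rightarrow> complex" where "f n = 1 / of_nat n" for n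
  have norm: "norm (f n) = 1 / real n" for n by (simp add: f_def norm_divide)
  have f: "f \<in> mult_unit_disc"
    by (auto simp: mult_unit_disc_def multiplicative_fun_def norm) (auto simp: f_def)
  have "(\<lambda>p. (1 - norm (f p)) / real p) summable_on {p. prime p}"
    by (rule summable_on_comparison_test[OF sum])
       (auto simp: norm prime_gt_0_nat Suc_le_eq intro!: divide_right_mono)
  then obtain s where s: "s > 0"
    and small: "\<And>N. (\<Sum>n=1..N. of_bool (f n \<noteq> 0) - norm (f n) powr s) \<le> 1 / 8 * real N"
    using small_power_close_to_support[OF f, of "1 / 8"] by auto
  have "(\<lambda>n. (1 / real n) powr s) \<longlonglongrightarrow> 0 powr s"
    using s by (intro tendsto_intros lim_1_over_n) auto
  hence "\<forall>\<^sub>F n in sequentially. (1 / real n) powr s < 1 / 2"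
    using s by (intro order_tendstoD(2)) auto
  then obtain M where M: "\<And>n. n \<ge> M \<Longrightarrow> (1 / real n) powr s < 1 / 2"
    by (auto simp: eventually_sequentially)
  let ?M = "Suc M"
  \<comment> \<open>The terms in the upper half of \<open>{1..2 * ?M}\<close> are at least \<open>1 / 2\<close>, so the mean over
    \<open>{1..2 * ?M}\<close> is at least \<open>1 / 4\<close>, which exceeds the bound \<open>1 / 8\<close>.\<close>
  have "real ?M / 2 = (\<Sum>n\<in>{Suc ?M..2 * ?M}. 1 / 2)" by simp
  also have "\<dots> \<le> (\<Sum>n\<in>{Suc ?M..2 * ?M}. of_bool (f n \<noteq> 0) - norm (f n) powr s)"
  proof (intro sum_mono)
    fix n assume "n \<in> {Suc ?M..2 * ?M}"
    thus "1 / 2 \<le> of_bool (f n \<noteq> 0) - norm (f n) powr s"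
      using M[of n] by (simp add: norm) (simp add: f_def)
  qed
  also have "\<dots> \<le> (\<Sum>n=1..2 * ?M. of_bool (f n \<noteq> 0) - norm (f n) powr s)"
  proof (intro sum_mono2)
    fix n assume "n \<in> {1..2 * ?M} - {Suc ?M..2 * ?M}"
    hence "n \<ge> 1" by simp
    thus "0 \<le> of_bool (f n \<noteq> 0) - norm (f n) powr s"
      using powr_mono2[of s "1 / real n" 1] s by (simp add: norm) (simp add: f_def)
  qed auto
  also have "\<dots> \<le> 1 / 8 * real (2 * ?M)" by (rule small)
  finally show False by simp
qed

section \<open>Level sets\<close>

lemma mult_unit_disc_mult:
  assumes "f \<in> mult_unit_disc" "g \<in> mult_unit_disc"
  shows "(\<lambda>n. f n * g n) \<in> mult_unit_disc"
proof -
  have "norm (f n) * norm (g n) \<le> 1 * 1" if "n \<ge> 1" for n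
    using assms[THEN mult_unit_discD(3)] that by (intro mult_mono) auto
  thus ?thesis using assms by (auto simp: mult_unit_disc_def multiplicative_fun_def norm_mult mult_ac)
qed

lemma mult_unit_disc_one: "(\<lambda>_. 1) \<in> mult_unit_disc"
  by (simp add: mult_unit_disc_def multiplicative_fun_def)

lemma mult_unit_disc_cnj: "f \<in> mult_unit_disc \<Longrightarrow> (\<lambda>n. cnj (f n)) \<in> mult_unit_disc"
  by (simp add: mult_unit_disc_def multiplicative_fun_def)

lemma mult_unit_disc_power: "f \<in> mult_unit_disc \<Longrightarrow> (\<lambda>n. f n ^ k) \<in> mult_unit_disc"
  by (simp add: mult_unit_disc_def multiplicative_fun_def norm_power power_le_one power_mult_distrib)

lemma mult_unit_disc_support: "f \<in> mult_unit_disc \<Longrightarrow> (\<lambda>n. of_bool (f n \<noteq> 0)) \<in> mult_unit_disc"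
  by (auto simp: mult_unit_disc_def multiplicative_fun_def)

text \<open>
  Away from the boundary of \<open>J\<close> the indicator is locally constant. On the boundary the continuous
  function \<open>norm z powr s * (1 - F z)\<close> vanishes, at \<open>0\<close> because of the power and elsewhere because
  \<open>F = 1\<close>, and it dominates the product in absolute value.
\<close>
lemma continuous_cutoff_indicator:
  fixes F :: "complex \<Rightarrow> real"
  assumes "continuous_on UNIV F" "\<And>z. z \<in> frontier J - {0} \<Longrightarrow> F z = 1" "s > 0"
  shows "continuous_on UNIV (\<lambda>z. indicator J z * norm z powr s * (1 - F z))"
proof -
  define D where "D z = norm z powr s * (1 - F z)" for z
  have D: "isCont D z" for z
  proof -
    have "continuous_on UNIV D" unfolding D_def using assms(1,3)
      by (intro continuous_on_mult continuous_on_powr' continuous_on_diff continuous_on_norm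
            continuous_on_const continuous_on_id) auto
    thus ?thesis by (simp add: continuous_on_eq_continuous_at)
  qed
  have "isCont (\<lambda>z. indicator J z * D z) z" for z
  proof (cases "z \<in> frontier J")
    case True
    hence "D z = 0" using assms(2,3) by (cases "z = 0") (auto simp: D_def)
    hence "(D \<longlongrightarrow> 0) (at z)" using D[of z] by (simp add: isCont_def)
    hence "((\<lambda>z. indicator J z * D z) \<longlongrightarrow> 0) (at z)"
      by (rule Lim_null_comparison[rotated, OF tendsto_norm_zero]) (auto simp: indicator_def)
    thus ?thesis using \<open>D z = 0\<close> by (simp add: isCont_def)
  next
    case False
    then consider "z \<in> interior J" | "z \<in> interior (- J)"
      by (auto simp: frontier_def interior_complement)
    hence "\<exists>c. \<forall>\<^sub>F w in nhds z. indicator J w = (c :: real)"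
    proof cases
      case 1
      hence "\<forall>\<^sub>F w in nhds z. w \<in> interior J" by (simp add: eventually_nhds_in_open)
      hence "\<forall>\<^sub>F w in nhds z. indicator J w = (1 :: real)"
        by eventually_elim (use interior_subset in \<open>auto simp: indicator_def\<close>)
      thus ?thesis ..
    next
      case 2
      hence "\<forall>\<^sub>F w in nhds z. w \<in> interior (- J)" by (simp add: eventually_nhds_in_open)
      hence "\<forall>\<^sub>F w in nhds z. indicator J w = (0 :: real)"
        by eventually_elim (use interior_subset in \<open>auto simp: indicator_def\<close>)
      thus ?thesis ..
    qed
    then obtain c where "\<forall>\<^sub>F w in nhds z. indicator J w = (c :: real)" ..
    hence "\<forall>\<^sub>F w in nhds z. indicator J w * D w = c * D w" by eventually_elim simp
    moreover have "isCont (\<lambda>w. c * D w) z" by (intro continuous_intros D)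
    ultimately show ?thesis by (subst isCont_cong)
  qed
  thus ?thesis by (simp add: continuous_on_eq_continuous_at D_def mult.assoc)
qed

context
  fixes a :: "nat \<Rightarrow> complex" and A :: real
  assumes a: "\<And>n. n \<ge> 1 \<Longrightarrow> norm (a n) \<le> A"
    and orth: "\<And>p q. prime p \<Longrightarrow> prime q \<Longrightarrow> p \<noteq> q \<Longrightarrow> zero_mean (\<lambda>n. a (p * n) * cnj (a (q * n)))"
begin

lemma zero_mean_mult_unit_disc:
  assumes f: "f \<in> mult_unit_disc"
  shows "zero_mean (\<lambda>n. f n * a n)"
proof (rule katai_criterion[where P = "{p. prime p}" and c = f and h = f, OF a orth])
  show "f (p * m) = f p * f m" if "p \<in> {p. prime p}" "m \<ge> 1" "\<not> p dvd m" for p m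
    using that mult_unit_discD(2)[OF f, of p m] by (simp add: prime_imp_coprime prime_gt_0_nat Suc_le_eq)
qed (use f in \<open>auto simp: not_summable_prime_reciprocals mult_unit_discD prime_gt_0_nat Suc_le_eq
       intro!: mult_unit_discD(3)\<close>)

text \<open>
  For \<open>f p = z\<close> and \<open>p\<close> not dividing \<open>m\<close>, membership of \<open>f (p * m)\<close> in \<open>K\<close> means that the
  componentwise product of \<open>z\<close> and \<open>f m\<close> lies in \<open>K\<close>, a condition on \<open>m\<close> alone.
\<close>
lemma zero_mean_level_set_concentration_point:
  assumes f: "multiplicative_vec r f" and z: "z \<in> cvec r" and conc: "concentration_point f z"
  shows "zero_mean (\<lambda>n. indicator {n. n \<ge> 1 \<and> f n \<in> K} n * a n)"
proof (rule katai_criterion[where P = "{p. prime p \<and> f p = z}" and c = "\<lambda>_. 1"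
      and h = "\<lambda>m. of_bool (map2 (*) z (f m) \<in> K)", OF a orth])
  show "\<not> (\<lambda>p. 1 / real p) summable_on {p. prime p \<and> f p = z}"
    using conc by (simp add: concentration_point_def)
  fix p m assume p: "p \<in> {p. prime p \<and> f p = z}" and m: "(m::nat) \<ge> 1" "\<not> p dvd m"
  have pm: "p \<ge> 1" "coprime p m" using p m by (auto simp: prime_imp_coprime prime_gt_0_nat Suc_le_eq)
  have len: "length (f n) = r" if "n \<ge> 1" for n
    using f that by (auto simp: multiplicative_vec_def cvec_def)
  have "f (p * m) = map2 (*) z (f m)"
  proof (rule nth_equalityI)
    show "length (f (p * m)) = length (map2 (*) z (f m))"
      using len[of "p * m"] len[of m] z m pm by (simp add: cvec_def Suc_le_eq)
    fix i assume "i < length (f (p * m))"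
    hence i: "i < r" using len[of "p * m"] pm m by (simp add: Suc_le_eq)
    hence "f (p * m) ! i = f p ! i * f m ! i"
      using f pm m by (auto simp: multiplicative_vec_def multiplicative_fun_def)
    thus "f (p * m) ! i = map2 (*) z (f m) ! i"
      using i p z len[OF m(1)] by (simp add: cvec_def)
  qed
  thus "indicator {n. n \<ge> 1 \<and> f n \<in> K} (p * m) = 1 * (of_bool (map2 (*) z (f m) \<in> K) :: complex)"
    using pm m by (simp add: indicator_def Suc_le_eq)
qed (auto simp: indicator_def)

text \<open>
  The property of having mean zero against \<open>a\<close> is not preserved by products. The induction therefore
  runs over the sequences \<open>b\<close> whose products with all monomials in \<open>f\<close> and \<open>cnj f\<close> have this
  property (\<open>stable\<close>): multiplication by a polynomial in \<open>f\<close> preserves this class, and a product of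
  two polynomials acts as a composition.
\<close>
lemma zero_mean_real_polynomial:
  fixes G :: "complex \<Rightarrow> real"
  assumes f: "f \<in> mult_unit_disc" and G: "real_polynomial_function G"
  shows "zero_mean (\<lambda>n. of_real (G (f n)) * a n)"
proof -
  define stable where "stable b \<longleftrightarrow> (\<forall>i j. zero_mean (\<lambda>n. b n * (f n ^ i * cnj (f n) ^ j * a n)))" for b
  have times_f: "stable (\<lambda>n. f n * b n)" if "stable b" for b
    unfolding stable_def
  proof (intro allI)
    fix i j
    have "zero_mean (\<lambda>n. b n * (f n ^ Suc i * cnj (f n) ^ j * a n))"
      using that unfolding stable_def by blast
    thus "zero_mean (\<lambda>n. f n * b n * (f n ^ i * cnj (f n) ^ j * a n))" by (simp add: mult_ac)
  qed
  have times_cnj: "stable (\<lambda>n. cnj (f n) * b n)" if "stable b" for b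
    unfolding stable_def
  proof (intro allI)
    fix i j
    have "zero_mean (\<lambda>n. b n * (f n ^ i * cnj (f n) ^ Suc j * a n))"
      using that unfolding stable_def by blast
    thus "zero_mean (\<lambda>n. cnj (f n) * b n * (f n ^ i * cnj (f n) ^ j * a n))" by (simp add: mult_ac)
  qed
  have cmult: "stable (\<lambda>n. c * b n)" if "stable b" for b c
    using that zero_mean_cmult unfolding stable_def by (simp add: mult.assoc)
  have add: "stable (\<lambda>n. b n + b' n)" if "stable b" "stable b'" for b b'
    using that zero_mean_add unfolding stable_def by (simp add: distrib_right)
  have "stable (\<lambda>n. of_real (G (f n)) * b n)" if "stable b" for b
    using G that
  proof (induction arbitrary: b rule: real_polynomial_function.induct)
    case (linear l)
    \<comment> \<open>A real-linear functional on \<open>\<complex>\<close> is \<open>z \<mapsto> \<alpha> z + \<beta> cnj z\<close>.\<close>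
    define \<alpha> \<beta> where "\<alpha> = (of_real (l 1) - \<i> * of_real (l \<i>)) / 2"
      and "\<beta> = (of_real (l 1) + \<i> * of_real (l \<i>)) / 2"
    have l: "of_real (l z) = \<alpha> * z + \<beta> * cnj z" for z
    proof -
      interpret bounded_linear l by fact
      have "z = Re z *\<^sub>R 1 + Im z *\<^sub>R \<i>" by (simp add: complex_eq_iff)
      hence "l z = l (Re z *\<^sub>R 1 + Im z *\<^sub>R \<i>)" by (rule arg_cong)
      also have "\<dots> = Re z * l 1 + Im z * l \<i>" by (simp only: add scale) simp
      finally show ?thesis by (simp add: \<alpha>_def \<beta>_def complex_eq_iff field_simps)
    qed
    show ?case unfolding l
      using add[OF cmult[OF times_f[OF linear(2)], of \<alpha>] cmult[OF times_cnj[OF linear(2)], of \<beta>]]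
      by (simp add: algebra_simps)
  next
    case (const c)
    thus ?case by (rule cmult)
  next
    case (add G1 G2)
    from \<open>\<And>b b'. stable b \<Longrightarrow> stable b' \<Longrightarrow> stable (\<lambda>n. b n + b' n)\<close>[OF add.IH(1)[OF add.prems] add.IH(2)[OF add.prems]]
    show ?case by (simp add: algebra_simps)
  next
    case (mult G1 G2)
    from mult.IH(1)[OF mult.IH(2)[OF mult.prems]] show ?case by (simp add: mult.assoc)
  qed
  moreover have "stable (\<lambda>_. 1)"
    using f
    by (auto simp: stable_def simp flip: mult.assoc
          intro!: zero_mean_mult_unit_disc mult_unit_disc_mult mult_unit_disc_power mult_unit_disc_cnj)
  ultimately have "stable (\<lambda>n. of_real (G (f n)) * 1)" by blast
  hence "zero_mean (\<lambda>n. of_real (G (f n)) * 1 * (f n ^ 0 * cnj (f n) ^ 0 * a n))"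
    unfolding stable_def by blast
  thus ?thesis by simp
qed

lemma zero_mean_continuous:
  fixes G :: "complex \<Rightarrow> real"
  assumes f: "f \<in> mult_unit_disc" and G: "continuous_on UNIV G"
  shows "zero_mean (\<lambda>n. of_real (G (f n)) * a n)"
proof (rule zero_mean_approx)
  fix \<epsilon> :: real assume \<epsilon>: "\<epsilon> > 0"
  have A: "A \<ge> 0" using a[of 1] norm_ge_zero[of "a 1"] by linarith
  obtain H where H: "real_polynomial_function H" and close: "\<And>z. z \<in> cball 0 1 \<Longrightarrow> \<bar>G z - H z\<bar> < \<epsilon> / (A + 1)"
    using Stone_Weierstrass_real_polynomial_function[of "cball 0 1" G "\<epsilon> / (A + 1)"] \<epsilon> A
      continuous_on_subset[OF G] by auto
  have "(\<Sum>n=1..N. norm (of_real (G (f n)) * a n - of_real (H (f n)) * a n)) \<le> \<epsilon> * real N" for N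
  proof -
    have "norm (of_real (G (f n)) * a n - of_real (H (f n)) * a n) \<le> \<epsilon>" if n: "n \<ge> 1" for n
    proof -
      have "norm (of_real (G (f n)) * a n - of_real (H (f n)) * a n) = \<bar>G (f n) - H (f n)\<bar> * norm (a n)"
        by (simp add: norm_mult flip: left_diff_distrib of_real_diff)
      also have "\<dots> \<le> (\<epsilon> / (A + 1)) * (A + 1)"
        using close[of "f n"] mult_unit_discD(3)[OF f n] a[OF n] A \<epsilon> by (intro mult_mono) auto
      also have "\<dots> = \<epsilon>" using A by simp
      finally show ?thesis .
    qed
    hence "(\<Sum>n=1..N. norm (of_real (G (f n)) * a n - of_real (H (f n)) * a n)) \<le> real (card {1..N}) * \<epsilon>"
      by (intro sum_bounded_above) auto
    thus ?thesis by (simp add: mult.commute)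
  qed
  thus "\<exists>b'. zero_mean b' \<and> (\<forall>\<^sub>F N in sequentially.
      (\<Sum>n=1..N. norm (of_real (G (f n)) * a n - b' n)) \<le> \<epsilon> * real N)"
    using zero_mean_real_polynomial[OF f H] by (intro exI[of _ "\<lambda>n. of_real (H (f n)) * a n"]) auto
qed

text \<open>
  The approximation is \<open>G z = indicator J z * norm z powr s * (1 - F z)\<close>. Its error at a nonzero
  \<open>z\<close> of norm at most \<open>1\<close> is at most \<open>(1 - norm z powr s) + F z\<close>, and the mean of each of the two
  terms along \<open>f\<close> is small.
\<close>
lemma zero_mean_level_set_null_boundary:
  assumes f: "f \<in> mult_unit_disc" and nz: "norm1 f \<noteq> 0" and J: "J \<in> A_star f"
  shows "zero_mean (\<lambda>n. of_bool (f n \<in> J) * a n)"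
proof (rule zero_mean_approx)
  fix \<epsilon> :: real assume \<epsilon>: "\<epsilon> > 0"
  have A: "A \<ge> 0" using a[of 1] norm_ge_zero[of "a 1"] by linarith
  \<comment> \<open>The power costs a mean of \<open>\<delta>\<close>, and \<open>F\<close> costs \<open>2 * \<delta>\<close>, since a limsup of at most
    \<open>\<delta>\<close> bounds the averages only by numbers larger than \<open>\<delta>\<close>.\<close>
  define \<delta> where "\<delta> = \<epsilon> / (3 * (A + 1))"
  have \<delta>: "\<delta> > 0" using A \<epsilon> by (simp add: \<delta>_def)
  have J0: "0 \<notin> J" and null: "frontier J - {0} \<in> null_sets_of f" using J by (auto simp: A_star_def)
  obtain s where s: "s > 0"
    and powr: "\<And>N. (\<Sum>n=1..N. of_bool (f n \<noteq> 0) - norm (f n) powr s) \<le> \<delta> * real N"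
    using small_power_close_to_support[OF f norm1_nonzero_imp_summable[OF f nz] \<delta>] by auto
  obtain F :: "complex \<Rightarrow> real" where F: "continuous_on UNIV F" "range F \<subseteq> {0..1}"
      "\<And>z. z \<in> frontier J - {0} \<Longrightarrow> F z = 1"
    and limsup: "limsup (\<lambda>N. ereal ((\<Sum>n | 1 \<le> n \<and> n \<le> N \<and> f n \<noteq> 0. F (f n)) / real N)) \<le> ereal \<delta>"
    using null \<delta> unfolding null_sets_of_def by blast
  have F01: "0 \<le> F z" "F z \<le> 1" for z using F(2) by (auto simp: image_subset_iff)
  define G where "G z = indicator J z * norm z powr s * (1 - F z)" for z
  have "\<forall>\<^sub>F N in sequentially. ereal ((\<Sum>n | 1 \<le> n \<and> n \<le> N \<and> f n \<noteq> 0. F (f n)) / real N) < ereal (2 * \<delta>)"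
    using \<delta> by (intro Limsup_lessD le_less_trans[OF limsup]) simp
  hence "\<forall>\<^sub>F N in sequentially. (\<Sum>n=1..N. norm (of_bool (f n \<in> J) * a n - of_real (G (f n)) * a n)) \<le> \<epsilon> * real N"
    using eventually_gt_at_top[of 0]
  proof eventually_elim
    case (elim N)
    have "(\<Sum>n=1..N. norm (of_bool (f n \<in> J) * a n - of_real (G (f n)) * a n))
        \<le> (\<Sum>n=1..N. ((of_bool (f n \<noteq> 0) - norm (f n) powr s) + (if f n \<noteq> 0 then F (f n) else 0)) * A)"
    proof (intro sum_mono)
      fix n assume "n \<in> {1..N}"
      hence n: "n \<ge> 1" by simp
      have le1: "norm (f n) powr s \<le> 1" using powr_mono2[of s "norm (f n)" 1] s mult_unit_discD(3)[OF f n] by simp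
      have G01: "\<bar>of_bool (f n \<in> J) - G (f n)\<bar>
          \<le> (of_bool (f n \<noteq> 0) - norm (f n) powr s) + (if f n \<noteq> 0 then F (f n) else 0)"
      proof (cases "f n \<in> J")
        case True
        hence nz: "f n \<noteq> 0" using J0 by auto
        have "norm (f n) powr s * (1 - F (f n)) \<le> 1 * 1"
          using le1 F01[of "f n"] by (intro mult_mono) auto
        moreover have "norm (f n) powr s * F (f n) \<le> 1 * F (f n)"
          using le1 F01[of "f n"] by (intro mult_right_mono) auto
        ultimately show ?thesis using True nz by (simp add: G_def algebra_simps)
      next
        case False
        thus ?thesis using le1 F01[of "f n"] by (auto simp: G_def)
      qed
      have "norm (of_bool (f n \<in> J) * a n - of_real (G (f n)) * a n)
          = norm (complex_of_real (of_bool (f n \<in> J) - G (f n)) * a n)"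
        by (simp add: left_diff_distrib)
      also have "\<dots> = \<bar>of_bool (f n \<in> J) - G (f n)\<bar> * norm (a n)"
        by (simp only: norm_mult norm_of_real)
      also have "\<dots> \<le> ((of_bool (f n \<noteq> 0) - norm (f n) powr s) + (if f n \<noteq> 0 then F (f n) else 0)) * A"
        using G01 a[OF n] by (intro mult_mono) auto
      finally show "norm (of_bool (f n \<in> J) * a n - of_real (G (f n)) * a n) \<le> \<dots>" .
    qed
    also have "\<dots> = ((\<Sum>n=1..N. of_bool (f n \<noteq> 0) - norm (f n) powr s)
        + (\<Sum>n=1..N. if f n \<noteq> 0 then F (f n) else 0)) * A"
      by (simp only: sum.distrib flip: sum_distrib_right)
    also have "(\<Sum>n=1..N. if f n \<noteq> 0 then F (f n) else 0) = (\<Sum>n | 1 \<le> n \<and> n \<le> N \<and> f n \<noteq> 0. F (f n))"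
      by (subst sum.inter_filter[symmetric]) (auto intro!: sum.cong)
    also have "((\<Sum>n=1..N. of_bool (f n \<noteq> 0) - norm (f n) powr s)
        + (\<Sum>n | 1 \<le> n \<and> n \<le> N \<and> f n \<noteq> 0. F (f n))) * A \<le> (\<delta> * N + 2 * \<delta> * N) * A"
      using elim powr[of N] A by (intro mult_right_mono add_mono) (auto simp: divide_less_eq)
    also have "\<dots> \<le> (\<delta> * N + 2 * \<delta> * N) * (A + 1)"
      using \<delta> by (intro mult_left_mono) auto
    also have "\<dots> = (\<delta> * (3 * (A + 1))) * N" by (simp add: algebra_simps)
    also have "\<delta> * (3 * (A + 1)) = \<epsilon>" using A by (simp add: \<delta>_def)
    finally show ?case .
  qed
  moreover have "zero_mean (\<lambda>n. of_real (G (f n)) * a n)"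
    unfolding G_def by (intro zero_mean_continuous f continuous_cutoff_indicator F s)
  ultimately show "\<exists>b'. zero_mean b' \<and> (\<forall>\<^sub>F N in sequentially.
      (\<Sum>n=1..N. norm (of_bool (f n \<in> J) * a n - b' n)) \<le> \<epsilon> * real N)" by blast
qed

text \<open>
  Adding the point \<open>0\<close> to \<open>J\<close> adds the indicator of \<open>f n = 0\<close>, which is the difference of the two
  multiplicative functions \<open>1\<close> and \<open>of_bool (f n \<noteq> 0)\<close>.
\<close>
lemma zero_mean_level_set_A_class:
  assumes f: "f \<in> mult_unit_disc" and nz: "norm1 f \<noteq> 0" and K: "K \<in> A_class f"
  shows "zero_mean (\<lambda>n. of_bool (f n \<in> K) * a n)"
proof -
  from K consider "K \<in> A_star f" | J where "J \<in> A_star f" "K = J \<union> {0}" by (auto simp: A_class_def)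
  thus ?thesis
  proof cases
    case 1
    thus ?thesis by (rule zero_mean_level_set_null_boundary[OF f nz])
  next
    case 2
    have J0: "0 \<notin> J" using 2(1) by (auto simp: A_star_def)
    have "zero_mean (\<lambda>n. (of_bool (f n \<in> J) * a n + 1 * a n) + (-1) * (of_bool (f n \<noteq> 0) * a n))"
      by (intro zero_mean_add zero_mean_cmult zero_mean_level_set_null_boundary[OF f nz 2(1)]
            zero_mean_mult_unit_disc mult_unit_disc_one mult_unit_disc_support f)
    thus ?thesis by (rule zero_mean_cong) (use J0 in \<open>auto simp: 2(2)\<close>)
  qed
qed

end

theorem theorem3p7:
  fixes a :: "nat \<Rightarrow> complex"
  assumes bounded_a: "bounded (a ` {1..})"
    and orthogonality: "\<And>p q :: nat. prime p \<Longrightarrow> prime q \<Longrightarrow> p \<noteq> q \<Longrightarrow>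
      (\<lambda>x::real. \<Sum>n | 1 \<le> n \<and> real n \<le> x. a (p * n) * cnj (a (q * n)))
        \<in> o[at_top](\<lambda>x. complex_of_real x)"
  shows "\<forall>E \<in> E_cpt_infinity \<union> E_boundary.
    (\<lambda>x::real. \<Sum>n | 1 \<le> n \<and> real n \<le> x. indicator E n * a n)
      \<in> o[at_top](\<lambda>x. complex_of_real x)"
proof
  obtain A where a: "\<And>n. n \<ge> 1 \<Longrightarrow> norm (a n) \<le> A"
    using bounded_a by (auto simp: bounded_iff)
  have orth: "zero_mean (\<lambda>n. a (p * n) * cnj (a (q * n)))" if "prime p" "prime q" "p \<noteq> q" for p q
    using orthogonality[OF that] by (simp only: smallo_iff_zero_mean)
  fix E assume "E \<in> E_cpt_infinity \<union> E_boundary"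
  hence "zero_mean (\<lambda>n. indicator E n * a n)"
  proof
    assume "E \<in> E_cpt_infinity"
    then obtain r f K z where "E = {n. n \<ge> 1 \<and> f n \<in> K}" "multiplicative_vec r f" "z \<in> cvec r"
        "concentration_point f z"
      by (auto simp: E_cpt_infinity_def E_cpt_def)
    thus ?thesis using zero_mean_level_set_concentration_point[OF a orth] by blast
  next
    assume "E \<in> E_boundary"
    then obtain f K where E: "E = {n. n \<ge> 1 \<and> f n \<in> K}" and f: "f \<in> mult_unit_disc" "norm1 f \<noteq> 0" "K \<in> A_class f"
      by (auto simp: E_boundary_def)
    have "zero_mean (\<lambda>n. of_bool (f n \<in> K) * a n)"
      by (rule zero_mean_level_set_A_class[OF a orth f])
    thus ?thesis by (rule zero_mean_cong) (auto simp: E indicator_def)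
  qed
  thus "(\<lambda>x::real. \<Sum>n | 1 \<le> n \<and> real n \<le> x. indicator E n * a n) \<in> o[at_top](\<lambda>x. complex_of_real x)"
    by (simp only: smallo_iff_zero_mean)
qed

end
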